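(* For integers $n\ge 1$ and $k\ge 0$ put $$J_k^n=\int_{0}^{1}x^kB_n\left(\left\{\frac{1}{x}\right\}\right)dx.$$ Then, for every $n\ge 1$, $$J_k^n=\frac{1}{(k+1)\binom{k}{n}}\Bigg(\sum_{j=0}^{[n/2]}\binom{k-n+2j}{2j}B_{2j}+(k-n+1)\bigg(\frac{1}{2}-\zeta(k-n+2)\bigg)\Bigg)\qquad\text{for } k\ge n,$$ $$J_{n-1}^n=\sum_{j=1}^{[n/2]}\frac{B_{2j}}{2j}+\frac{1}{2}-\gamma,$$ and $$J_{k}^n=\frac{1}{k+1}\binom{n}{k}\Bigg(\sum_{j=[(n-k+1)/2]}^{[n/2]}\frac{B_{2j}}{\binom{2j}{k-n+2j}}+(n-k)(n-k-1)\,b_{n-k-2}\Bigg)\qquad\text{for } 0\le k\le n-2.$$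
   Context: $\{t\}=t-\lfloor t\rfloor$ denotes the fractional part and $[t]=\lfloor t\rfloor$ the integer part of the real number $t$. $B_n(x)$ are the Bernoulli polynomials, defined by $\frac{te^{xt}}{e^t-1}=\sum_{n=0}^{\infty}B_n(x)\frac{t^n}{n!}$, and $B_n=B_n(0)$ are the Bernoulli numbers (so $B_1=-1/2$). $\gamma$ is the Euler--Mascheroni constant, $\zeta$ the Riemann zeta function and $\zeta'$ its derivative. The sequence $a_n$ ($n\ge 0$) is defined by $$a_{n}=\begin{cases}-\zeta'(-n),& n=0,2,4,\dots,\\ \frac{B_{n+1}}{n+1}\left(\frac{\zeta'(n+1)}{\zeta(n+1)}-\log(2\pi)-\gamma\right), & n=1,3,5,\dots,\end{cases}$$ and the sequence $b_n$ ($n\ge 0$) by $$b_n=a_n-\frac{1}{n+1}\sum_{k=1}^{n+1}\binom{n+1}{k}\frac{B_{n+1-k}}{k}.$$ An empty sum is zero. *)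

theory Defs
  imports "HOL-Complex_Analysis.Complex_Analysis"
begin

definition bernpoly :: "nat \<Rightarrow> real \<Rightarrow> real" where
  "bernpoly n x = fact n * fps_nth (fps_X * fps_exp x / (fps_exp 1 - 1)) n"

(* The quotient above is exact, although the denominator is not a unit. *)
lemma bernpoly_generating_function:
  "Abs_fps (\<lambda>n. bernpoly n x / fact n) * (fps_exp 1 - 1) = fps_X * fps_exp x"
proof -
  let ?g = "fps_exp 1 - 1 :: real fps"
  have nz: "?g \<noteq> 0"
    by (auto simp: fps_eq_iff intro!: exI[of _ 1])
  have "fps_nth ?g 0 = 0" "fps_nth ?g 1 \<noteq> 0"
    by simp_all
  then have "subdegree ?g = 1"
    by (intro subdegreeI) auto
  moreover have "subdegree (fps_X * fps_exp x) = 1"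
    by (intro subdegreeI) auto
  ultimately have "?g dvd fps_X * fps_exp x"
    using nz by (subst fps_dvd_iff) auto
  moreover have "Abs_fps (\<lambda>n. bernpoly n x / fact n) = fps_X * fps_exp x / ?g"
    by (simp add: fps_eq_iff bernpoly_def)
  ultimately show ?thesis
    by simp
qed

definition bernoulli :: "nat \<Rightarrow> real" where
  "bernoulli n = bernpoly n 0"

(* The analytic continuation of the Dirichlet series to the complex plane without 1; by the
   identity theorem its values there do not depend on the choice.  The value at 1 is junk. *)
definition zeta :: "complex \<Rightarrow> complex" where
  "zeta = (SOME f. f holomorphic_on - {1} \<and>
     (\<forall>s. Re s > 1 \<longrightarrow> (\<lambda>n. of_nat (Suc n) powr (- s)) sums f s))"

(* Complex-valued only because zeta is; all values are in fact real. *)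
definition a_seq :: "nat \<Rightarrow> complex" where
  "a_seq n =
     (if even n then - deriv zeta (- of_nat n)
      else of_real (bernoulli (n + 1)) / of_nat (n + 1) *
        (deriv zeta (of_nat (n + 1)) / zeta (of_nat (n + 1))
          - of_real (ln (2 * pi)) - euler_mascheroni))"

definition b_seq :: "nat \<Rightarrow> complex" where
  "b_seq n = a_seq n - 1 / of_nat (n + 1) *
     (\<Sum>k = 1..n + 1. of_nat (n + 1 choose k) * of_real (bernoulli (n + 1 - k)) / of_nat k)"

definition J :: "nat \<Rightarrow> nat \<Rightarrow> real" where
  "J k n = integral {0..1} (\<lambda>x. x ^ k * bernpoly n (frac (1 / x)))"

end

theory Submission
  imports Defs "HOL-Real_Asymp.Real_Asymp"
begin

text \<open>
Substituting u = 1/x turns J k n into the integral of B_n({u}) u^(-k-2) over [1, \<infinity>), a special value of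

  T_n(c) = \<integral> B_n({u}) u^(-c) du  over [1, \<infinity>)     (\<open>bern_tail\<close>, as a function of complex c).

Since B_(n+1)({u}) / (n+1) is a continuous antiderivative of B_n({u}) for n \<ge> 1, one integration by parts
links T_n(c) with T_(n+1)(c+1) (\<open>bern_tail_Suc\<close>).  At integer arguments this is a recurrence that lowers k and n
of J together (\<open>J_recurrence\<close>).  It preserves k - n, and each of the three closed forms is carried along it
by induction, because every step contributes exactly one Bernoulli number to the finite sum.  What remains are the
starting values.

If k \<ge> n, the start is J (d+1) 1, and T_1(s+1) is the remainder term in the Euler-Maclaurin formula
\<zeta>(s) = 1/(s-1) + 1/2 - s T_1(s+1) (\<open>Dirichlet_series_eq\<close>).
If k = n - 1, the start is J 0 1, an elementary sum of logarithms that converges to 1/2 - \<gamma>.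
If k \<le> n - 2, the start is J 0 m with m \<ge> 2, and b_(m-2) has to be recognised in it (\<open>J_0_eq_b_seq\<close>).
The definition of a_(m-2) depends on the parity of m, and so does the argument.

For even m, repeated integration by parts also continues T_1(s+1), hence zeta, to the whole plane.  Close to
s = 2 - m the continued formula reads

  \<zeta>(s) = - s(s+1)...(s+m-1) / m! * (rational part + T_m(s+m)).

One factor of the product vanishes at s = 2 - m, so \<zeta>'(2 - m) is the remaining factor at that point, and T_m(2) = J 0 m
appears in it (\<open>J_0_via_deriv_zeta_even\<close>).  The rational part comes from integrating B_m(u) u^(-c)
formally over [0, 1]; its only pole at s = 2 - m has the factor B_(m-1), which vanishes unless m = 2.

For odd m, insert the Fourier series of B_m.  Every term leads to the integral of sin(a u) / u^2 over
[1, \<infinity>) with a = 2\<pi>j, which up to an explicit integral over [0, 1] equals a (1 - \<gamma> - ln a); this is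
the classical asymptotics of the cosine integral (\<open>Cin_exists\<close>).  The terms ln(2\<pi>) + ln j of ln a,
weighted by j^(1-m), add up to ln(2\<pi>) \<zeta>(m-1) - \<zeta>'(m-1), and the Fourier series at 0 expresses \<zeta>(m-1) by
B_(m-1).  The integrals over [0, 1] add up to the finite sum in the definition of b (\<open>J_0_odd_index\<close>).
In this way the functional equation of zeta is avoided.
\<close>

section \<open>Bernoulli polynomials\<close>

text \<open>The generating function at x is the one at 0 times exp(xt); cancelling the common factor e^t - 1 is legitimate
since power series over a field form a domain.\<close>
lemma bernpoly_fps_eq:
  "Abs_fps (\<lambda>n. bernpoly n x / fact n) = Abs_fps (\<lambda>n. bernoulli n / fact n) * fps_exp x"
proof -
  have "fps_nth (fps_exp 1 - 1 :: real fps) 1 \<noteq> 0" by simp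
  then have nz: "(fps_exp 1 - 1 :: real fps) \<noteq> 0" by auto
  have "Abs_fps (\<lambda>n. bernpoly n x / fact n) * (fps_exp 1 - 1)
      = Abs_fps (\<lambda>n. bernpoly n 0 / fact n) * (fps_exp 1 - 1) * fps_exp x"
    by (simp only: bernpoly_generating_function) simp
  then have "Abs_fps (\<lambda>n. bernpoly n x / fact n) * (fps_exp 1 - 1)
      = Abs_fps (\<lambda>n. bernpoly n 0 / fact n) * fps_exp x * (fps_exp 1 - 1)"
    by (simp add: mult_ac)
  then show ?thesis using nz by (simp add: bernoulli_def)
qed

lemma bernpoly_expand: "bernpoly n x = (\<Sum>k\<le>n. real (n choose k) * bernoulli (n - k) * x ^ k)"
proof -
  have "bernpoly n x / fact n = fps_nth (Abs_fps (\<lambda>n. bernoulli n / fact n) * fps_exp x) n"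
    using arg_cong[OF bernpoly_fps_eq, of "\<lambda>f. fps_nth f n" x] by simp
  also have "\<dots> = (\<Sum>i=0..n. bernoulli i / fact i * (x ^ (n - i) / fact (n - i)))"
    by (simp add: fps_mult_nth)
  also have "\<dots> = (\<Sum>k=0..n. bernoulli (n - k) / fact (n - k) * (x ^ k / fact k))"
    by (subst sum.atLeastAtMost_rev) (auto intro!: sum.cong)
  finally have "bernpoly n x = (\<Sum>k=0..n. fact n * (bernoulli (n - k) / fact (n - k) * (x ^ k / fact k)))"
    by (simp add: field_simps sum_distrib_left)
  also have "\<dots> = (\<Sum>k\<le>n. real (n choose k) * bernoulli (n - k) * x ^ k)"
    by (rule sum.cong) (auto simp: binomial_fact field_simps)
  finally show ?thesis .
qed

lemma bernpoly_at_1: "bernpoly n 1 = bernoulli n + (if n = 1 then 1 else 0)"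
proof -
  have "Abs_fps (\<lambda>n. bernpoly n 1 / fact n)
      = Abs_fps (\<lambda>n. bernoulli n / fact n) * (fps_exp 1 - 1) + Abs_fps (\<lambda>n. bernoulli n / fact n)"
    by (simp add: bernpoly_fps_eq algebra_simps)
  also have "\<dots> = fps_X + Abs_fps (\<lambda>n. bernoulli n / fact n)"
    using bernpoly_generating_function[of 0] by (simp add: bernoulli_def)
  finally have "bernpoly n 1 / fact n = fps_nth (fps_X + Abs_fps (\<lambda>n. bernoulli n / fact n)) n"
    by (metis fps_nth_Abs_fps)
  then show ?thesis by (simp add: field_simps split: if_splits)
qed

text \<open>The recursion that determines the Bernoulli numbers: it says B_n(1) = B_n(0) for n \<noteq> 1.\<close>
lemma sum_binomial_bernoulli:
  "(\<Sum>k\<in>{1..n}. real (n choose k) * bernoulli (n - k)) = (if n = 1 then 1 else 0)"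
proof -
  have "bernpoly n 1 = (\<Sum>k\<in>{0..n}. real (n choose k) * bernoulli (n - k))"
    by (simp add: bernpoly_expand atMost_atLeast0)
  also have "\<dots> = bernoulli n + (\<Sum>k\<in>{1..n}. real (n choose k) * bernoulli (n - k))"
    by (subst sum.atLeast_Suc_atMost) auto
  finally show ?thesis using bernpoly_at_1[of n] by simp
qed

lemma bernoulli_0: "bernoulli 0 = 1"
  using sum_binomial_bernoulli[of 1] by simp

lemma bernoulli_1: "bernoulli 1 = -1/2"
  using sum_binomial_bernoulli[of 2] bernoulli_0 by (simp add: numeral_2_eq_2)

lemma bernpoly_0: "bernpoly 0 x = 1"
  by (simp add: bernpoly_expand bernoulli_0)

lemma bernpoly_1: "bernpoly 1 x = x - 1/2"
  using bernoulli_1 by (simp add: bernpoly_expand bernoulli_0)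

lemma has_field_derivative_bernpoly:
  "(bernpoly (Suc n) has_field_derivative real (Suc n) * bernpoly n x) (at x within S)"
proof -
  have eq: "bernpoly (Suc n) = (\<lambda>x. \<Sum>k\<le>Suc n. real (Suc n choose k) * bernoulli (Suc n - k) * x ^ k)"
    by (auto simp: bernpoly_expand)
  have "(bernpoly (Suc n) has_field_derivative
      (\<Sum>k\<le>Suc n. real (Suc n choose k) * bernoulli (Suc n - k) * (real k * x ^ (k - 1)))) (at x within S)"
    unfolding eq by (intro DERIV_sum DERIV_cmult DERIV_subset[OF DERIV_pow]) auto
  also have "(\<Sum>k\<le>Suc n. real (Suc n choose k) * bernoulli (Suc n - k) * (real k * x ^ (k - 1)))
     = (\<Sum>k\<le>n. real (Suc n choose Suc k) * bernoulli (n - k) * (real (Suc k) * x ^ k))"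
    by (subst sum.atMost_Suc_shift) simp
  also have "\<dots> = (\<Sum>k\<le>n. real (Suc n) * (real (n choose k) * bernoulli (n - k) * x ^ k))"
  proof (rule sum.cong)
    fix k
    have "real (Suc k) * real (Suc n choose Suc k) = real (Suc n) * real (n choose k)"
      using Suc_times_binomial[of k n] by (simp only: of_nat_mult[symmetric])
    then have "real (Suc k) * real (Suc n choose Suc k) * (bernoulli (n - k) * x ^ k) =
       real (Suc n) * real (n choose k) * (bernoulli (n - k) * x ^ k)" by (simp only:)
    then show "real (Suc n choose Suc k) * bernoulli (n - k) * (real (Suc k) * x ^ k) =
         real (Suc n) * (real (n choose k) * bernoulli (n - k) * x ^ k)" by (simp only: mult_ac)
  qed simp
  also have "\<dots> = real (Suc n) * bernpoly n x"
    by (simp add: bernpoly_expand sum_distrib_left)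
  finally show ?thesis .
qed

lemma continuous_on_bernpoly [continuous_intros]:
  assumes "continuous_on S f" shows "continuous_on S (\<lambda>x. bernpoly n (f x))"
  unfolding bernpoly_expand by (intro continuous_intros assms)

lemma bernpoly_bounded:
  obtains K where "K > 0" "\<And>x. x \<in> {0..1} \<Longrightarrow> \<bar>bernpoly n x\<bar> \<le> K"
proof -
  have "compact (bernpoly n ` {0..1})"
    by (intro compact_continuous_image continuous_on_bernpoly continuous_intros) simp
  then have "bounded (bernpoly n ` {0..1})" by (rule compact_imp_bounded)
  then show ?thesis using that by (auto simp: bounded_pos)
qed

section \<open>Fourier expansion of the periodic Bernoulli functions\<close>

lemma Dirichlet_kernel:
  "2 * sin (pi * x) * (\<Sum>k=1..N. cos (2 * pi * real k * x)) = sin ((2 * real N + 1) * pi * x) - sin (pi * x)"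
proof (induction N)
  case (Suc N)
  have "2 * sin (pi * x) * cos (2 * pi * real (Suc N) * x)
      = sin (pi * x + 2 * pi * real (Suc N) * x) + sin (pi * x - 2 * pi * real (Suc N) * x)"
    by (simp add: sin_add sin_diff)
  also have "pi * x - 2 * pi * real (Suc N) * x = - ((2 * real N + 1) * pi * x)"
    by (simp add: algebra_simps)
  also have "pi * x + 2 * pi * real (Suc N) * x = (2 * real (Suc N) + 1) * pi * x"
    by (simp add: algebra_simps)
  finally have "2 * sin (pi * x) * cos (2 * pi * real (Suc N) * x) =
      sin ((2 * real (Suc N) + 1) * pi * x) - sin ((2 * real N + 1) * pi * x)" by simp
  then show ?case using Suc by (simp add: distrib_left del: of_nat_Suc)
qed simp

text \<open>Partial sums of the Fourier series of the sawtooth differ from it by a function with derivative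
sin((2N+1)\<pi>x) / sin(\<pi>x), the Dirichlet kernel.  That derivative is not small, but integrating the fast oscillation
by parts once gains a factor 1/(2N+1).  The result is locally uniform convergence inside (0,1), which is what
termwise differentiation of the next Fourier series needs.\<close>
lemma sawtooth_remainder:
  fixes \<delta> x :: real
  assumes \<delta>: "0 < \<delta>" "\<delta> < 1/2" and x: "x \<in> {\<delta>..1-\<delta>}"
  shows "\<bar>(\<Sum>k=1..N. sin (2 * pi * real k * x) / (pi * real k)) - (1/2 - x)\<bar> \<le>
     (1 / sin (pi * \<delta>) + 1 / (sin (pi * \<delta>))\<^sup>2) / (2 * real N + 1)"
proof -
  define M where "M = 2 * real N + 1"
  have M: "M > 0" by (simp add: M_def)
  \<comment> \<open>w differs from r by the boundary term of that integration by parts; both vanish at 1/2.\<close>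
  define r where "r t = (\<Sum>k=1..N. sin (2 * pi * real k * t) / (pi * real k)) - (1/2 - t)" for t
  define w where "w t = r t + cos (M * pi * t) / (M * pi * sin (pi * t))" for t
  define \<sigma> where "\<sigma> = sin (pi * \<delta>)"
  have \<sigma>0: "\<sigma> > 0" unfolding \<sigma>_def using \<delta> by (intro sin_gt_zero) (auto simp: mult_less_cancel_left1)
  have m2: "- (pi / 2) \<le> pi * \<delta>" 
    using \<delta> mult_pos_pos[OF pi_gt_zero \<delta>(1)] pi_gt_zero by linarith
  have \<sigma>: "sin (pi * t) \<ge> \<sigma>" if t: "t \<in> {\<delta>..1-\<delta>}" for t
  proof (cases "t \<le> 1/2")
    case True
    then show ?thesis unfolding \<sigma>_def using t \<delta>
      by (intro sin_monotone_2pi_le m2) (auto simp: field_simps)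
  next
    case False
    have "pi * (1 - t) \<le> pi * (1/2)" using False by (intro mult_left_mono) auto
    moreover have "pi * \<delta> \<le> pi * (1 - t)" using t by (intro mult_left_mono) auto
    ultimately have "sin (pi * \<delta>) \<le> sin (pi * (1 - t))"
      by (intro sin_monotone_2pi_le m2) auto
    also have "\<dots> = sin (pi * t)" by (simp add: algebra_simps sin_diff)
    finally show ?thesis by (simp add: \<sigma>_def)
  qed
  have alg1: "2 * s * S = m - s \<Longrightarrow> s \<noteq> 0 \<Longrightarrow> 2 * S + 1 = m / s" for s S m :: real
    by (simp add: field_simps)
  have alg2: "s \<noteq> 0 \<Longrightarrow> P \<noteq> 0 \<Longrightarrow> m / s + ((- m * (P * pi)) * (P * pi * s) - c * (P * pi * (d * pi)))
      / (P * pi * s)\<^sup>2 = - c * d / (P * s\<^sup>2)" for s P m c d :: real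
    by (simp add: divide_simps) (simp add: algebra_simps power2_eq_square)
  have dw: "(w has_real_derivative - cos (M * pi * t) * cos (pi * t) / (M * (sin (pi * t))\<^sup>2)) (at t within S)"
    if t: "t \<in> {\<delta>..1-\<delta>}" for t S
  proof -
    have s: "sin (pi * t) > 0" using \<sigma>[OF t] \<sigma>0 by simp
    have "(r has_real_derivative (\<Sum>k=1..N. 2 * cos (2 * pi * real k * t)) + 1) (at t within S)"
    proof -
      have d: "((\<lambda>t. sin (2 * pi * real k * t) / (pi * real k)) has_real_derivative 2 * cos (2 * pi * real k * t)) (at t within S)"
        if "k \<in> {1..N}" for k
        using that by (auto intro!: derivative_eq_intros)
      have ds: "((\<lambda>t. \<Sum>k=1..N. sin (2 * pi * real k * t) / (pi * real k)) has_real_derivative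
         (\<Sum>k=1..N. 2 * cos (2 * pi * real k * t))) (at t within S)"
        by (rule DERIV_sum) (rule d)
      have "((\<lambda>t. 1/2 - t) has_real_derivative -1) (at t within S)"
        by (auto intro!: derivative_eq_intros)
      from DERIV_diff[OF ds this] show ?thesis unfolding r_def by simp
    qed
    also have "(\<Sum>k=1..N. 2 * cos (2 * pi * real k * t)) + 1 = sin (M * pi * t) / sin (pi * t)"
      unfolding M_def sum_distrib_left[symmetric]
      by (rule alg1[OF Dirichlet_kernel]) (use s in simp)
    finally have r': "(r has_real_derivative sin (M * pi * t) / sin (pi * t)) (at t within S)" .
    have q': "((\<lambda>t. cos (M * pi * t) / (M * pi * sin (pi * t))) has_real_derivative
       ((- sin (M * pi * t) * (M * pi)) * (M * pi * sin (pi * t)) - cos (M * pi * t) * (M * pi * (cos (pi * t) * pi)))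
        / (M * pi * sin (pi * t))\<^sup>2) (at t within S)"
      using s M by (auto intro!: derivative_eq_intros simp: power2_eq_square)
    have "(w has_real_derivative sin (M * pi * t) / sin (pi * t) +
       ((- sin (M * pi * t) * (M * pi)) * (M * pi * sin (pi * t)) - cos (M * pi * t) * (M * pi * (cos (pi * t) * pi)))
        / (M * pi * sin (pi * t))\<^sup>2) (at t within S)"
      unfolding w_def by (rule DERIV_add[OF r' q'])
    moreover have "sin (M * pi * t) / sin (pi * t) +
       ((- sin (M * pi * t) * (M * pi)) * (M * pi * sin (pi * t)) - cos (M * pi * t) * (M * pi * (cos (pi * t) * pi)))
        / (M * pi * sin (pi * t))\<^sup>2 = - cos (M * pi * t) * cos (pi * t) / (M * (sin (pi * t))\<^sup>2)"
      by (rule alg2) (use s M in auto)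
    ultimately show ?thesis by simp
  qed
  have half: "1/2 \<in> {\<delta>..1-\<delta>}" using \<delta> by auto
  have "w (1/2) = 0"
  proof -
    have s0: "sin (2 * pi * real k * (1/2)) = 0" for k
      using sin_npi[of k] by (simp add: mult.commute)
    have "cos (M * pi * (1/2)) = cos (pi * real N + pi / 2)" by (simp add: M_def field_simps)
    also have "\<dots> = 0" by (simp add: cos_add sin_npi2)
    finally show ?thesis unfolding w_def r_def by (simp only: s0) simp
  qed
  moreover have "norm (w x - w (1/2)) \<le> 1 / (M * \<sigma>\<^sup>2) * norm (x - 1/2)"
  proof (rule field_differentiable_bound[of "{\<delta>..1-\<delta>}"])
    fix t assume t: "t \<in> {\<delta>..1-\<delta>}"
    have "\<bar>cos (M * pi * t) * cos (pi * t)\<bar> \<le> 1 * 1"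
      unfolding abs_mult by (intro mult_mono) auto
    then have "\<bar>cos (M * pi * t) * cos (pi * t)\<bar> / (M * (sin (pi * t))\<^sup>2) \<le> 1 / (M * \<sigma>\<^sup>2)"
      using M \<sigma>0 \<sigma>[OF t] by (intro frac_le mult_mono power_mono) auto
    then show "norm (- cos (M * pi * t) * cos (pi * t) / (M * (sin (pi * t))\<^sup>2)) \<le> 1 / (M * \<sigma>\<^sup>2)"
      using M by (simp add: abs_mult)
  qed (use dw x half in auto)
  ultimately have "\<bar>w x\<bar> \<le> 1 / (M * \<sigma>\<^sup>2) * \<bar>x - 1/2\<bar>" by simp
  also have "\<dots> \<le> 1 / (M * \<sigma>\<^sup>2) * 1" using x \<delta> M by (intro mult_left_mono) auto
  finally have wx: "\<bar>w x\<bar> \<le> 1 / (M * \<sigma>\<^sup>2)" by simp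
  have "\<bar>cos (M * pi * x) / (M * pi * sin (pi * x))\<bar> \<le> 1 / (M * 1 * \<sigma>)"
    unfolding abs_divide
  proof (intro frac_le)
    have "M * 1 * \<sigma> \<le> M * pi * sin (pi * x)" using M \<sigma>[OF x] \<sigma>0 pi_gt3 by (intro mult_mono) auto
    then show "M * 1 * \<sigma> \<le> \<bar>M * pi * sin (pi * x)\<bar>" by simp
  qed (use M \<sigma>0 in auto)
  then have "\<bar>r x\<bar> \<le> 1 / (M * \<sigma>\<^sup>2) + 1 / (M * \<sigma>)" using wx unfolding w_def by linarith
  also have "\<dots> = (1 / \<sigma> + 1 / \<sigma>\<^sup>2) / M" using M \<sigma>0 by (simp add: field_simps)
  finally show ?thesis by (simp add: r_def \<sigma>_def M_def)
qed

text \<open>The k-th pair of conjugate terms of the expansion B_q(x)/q! = - \<Sum> exp(2\<pi>ijx) / (2\<pi>ij)^q over the nonzero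
integers j, with j = k+1 and -j combined; the phase q\<pi>/2 is the argument of i^q, so one formula serves both
parities of q.\<close>
definition bern_fourier_term :: "nat \<Rightarrow> nat \<Rightarrow> real \<Rightarrow> real" where
  "bern_fourier_term q k x = - 2 * cos (2 * pi * real (Suc k) * x - real q * pi / 2) / (2 * pi * real (Suc k)) ^ q"

definition bern_fourier :: "nat \<Rightarrow> real \<Rightarrow> real" where
  "bern_fourier q x = (\<Sum>k. bern_fourier_term q k x)"

lemma norm_bern_fourier_term_le:
  assumes q: "q \<ge> 2"
  shows "norm (bern_fourier_term q k x) \<le> 2 * inverse (real (Suc k) ^ 2)"
proof -
  define c where "c = 2 * pi * real (Suc k)"
  define y where "y = cos (c * x - real q * pi / 2)"
  have "1 * real (Suc k) \<le> c"
    unfolding c_def using pi_gt3 by (intro mult_right_mono) auto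
  then have le: "real (Suc k) \<le> c" by simp
  then have c: "c > 0" using of_nat_0_less_iff[of "Suc k", where 'a=real] by linarith
  have "real (Suc k) ^ 2 \<le> real (Suc k) ^ q" using q by (intro power_increasing) simp_all
  also have "\<dots> \<le> c ^ q" using le by (intro power_mono) simp_all
  finally have ge: "real (Suc k) ^ 2 \<le> c ^ q" .
  have "norm (bern_fourier_term q k x) = 2 * \<bar>y\<bar> / c ^ q"
    unfolding bern_fourier_term_def c_def[symmetric] y_def[symmetric] using c by (simp add: abs_mult)
  also have "\<dots> \<le> 2 / real (Suc k) ^ 2"
  proof (rule frac_le)
    show "2 * \<bar>y\<bar> \<le> 2" using abs_cos_le_one unfolding y_def by simp
  qed (use ge in simp_all)
  finally show ?thesis by (simp add: divide_inverse)
qed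

lemma summable_inverse_squares: "summable (\<lambda>k. 2 * inverse (real (Suc k) ^ 2))"
proof (rule summable_mult)
  have "summable (\<lambda>k. inverse (real k ^ 2))" by (rule inverse_power_summable) simp
  then show "summable (\<lambda>k. inverse (real (Suc k) ^ 2))" by (subst summable_Suc_iff)
qed

lemma summable_bern_fourier_term: "q \<ge> 2 \<Longrightarrow> summable (\<lambda>k. bern_fourier_term q k x)"
  by (rule summable_comparison_test'[OF summable_inverse_squares norm_bern_fourier_term_le])

lemma uniform_limit_bern_fourier: "q \<ge> 2 \<Longrightarrow> uniform_limit S (\<lambda>N x. \<Sum>k<N. bern_fourier_term q k x) (bern_fourier q) sequentially"
  unfolding bern_fourier_def by (rule Weierstrass_m_test[OF _ summable_inverse_squares]) (rule norm_bern_fourier_term_le)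

lemma has_field_derivative_bern_fourier_term:
  "(bern_fourier_term (Suc q) k has_real_derivative bern_fourier_term q k x) (at x within S)"
proof -
  have p: "2 * pi * real (Suc k) \<noteq> 0" by (simp del: of_nat_Suc)
  define c where "c = 2 * pi * real (Suc k)"
  have c: "c \<noteq> 0" unfolding c_def by (rule p)
  have d: "((\<lambda>x. cos (c * x - real (Suc q) * pi / 2)) has_real_derivative
      - sin (c * x - real (Suc q) * pi / 2) * c) (at x within S)"
  proof -
    have "((\<lambda>x. c * x - real (Suc q) * pi / 2) has_real_derivative c) (at x within S)"
      using DERIV_diff[OF DERIV_cmult[OF DERIV_ident, of c] DERIV_const] by simp
    from DERIV_chain'[OF this DERIV_cos] show ?thesis by (simp only: mult.commute)
  qed
  note * = DERIV_cdivide[OF DERIV_cmult[OF d, of "-2"], of "c ^ Suc q"]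
  have "c * x - real (Suc q) * pi / 2 = (c * x - real q * pi / 2) - pi/2"
    by (simp add: field_simps)
  then have "sin (c * x - real (Suc q) * pi / 2) = - cos (c * x - real q * pi / 2)"
    by (simp only: sin_diff cos_pi_half sin_pi_half)
  then have "- 2 * (- sin (c * x - real (Suc q) * pi / 2) * c) / c ^ Suc q = - 2 * cos (c * x - real q * pi / 2) / c ^ q"
    using c by (simp only: power_Suc) (simp add: divide_simps)
  then show ?thesis using * unfolding bern_fourier_term_def[abs_def] c_def by (simp only:)
qed

lemma continuous_on_bern_fourier: "q \<ge> 2 \<Longrightarrow> continuous_on S (bern_fourier q)"
proof (rule uniform_limit_theorem[OF _ uniform_limit_bern_fourier])
  show "\<forall>\<^sub>F N in sequentially. continuous_on S (\<lambda>x. \<Sum>k<N. bern_fourier_term q k x)"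
    unfolding bern_fourier_term_def by (intro always_eventually allI continuous_intros) (auto simp del: of_nat_Suc)
qed auto

lemma has_field_derivative_bern_fourier:
  assumes "q \<ge> 2" shows "(bern_fourier (Suc q) has_real_derivative bern_fourier q x) (at x)"
proof -
  have "((\<lambda>x. \<Sum>k. bern_fourier_term (Suc q) k x) has_real_derivative (\<Sum>k. bern_fourier_term q k x)) (at x)"
  proof (rule has_field_derivative_series'(2))
    show "uniformly_convergent_on UNIV (\<lambda>n x. \<Sum>i<n. bern_fourier_term q i x)"
      using uniform_limit_bern_fourier[OF assms] by (auto simp: uniformly_convergent_on_def)
    show "summable (\<lambda>n. bern_fourier_term (Suc q) n x)" using assms by (intro summable_bern_fourier_term) auto
  qed (auto intro!: has_field_derivative_bern_fourier_term)
  then show ?thesis by (simp add: bern_fourier_def[abs_def])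
qed

lemma bern_fourier_plus_nat: "bern_fourier q (x + real n) = bern_fourier q x"
proof -
  have "bern_fourier_term q k (x + real n) = bern_fourier_term q k x" for k
  proof -
    have "2 * pi * real (Suc k) * (x + real n) - real q * pi / 2 =
       (2 * pi * real (Suc k) * x - real q * pi / 2) + 2 * pi * real_of_int (int (Suc k * n))"
      by (simp add: algebra_simps)
    then have "cos (2 * pi * real (Suc k) * (x + real n) - real q * pi / 2) =
       cos (2 * pi * real (Suc k) * x - real q * pi / 2)"
      by (simp only: cos_add cos_int_2pin sin_int_2pin)
    then show ?thesis by (simp only: bern_fourier_term_def)
  qed
  then show ?thesis by (simp add: bern_fourier_def)
qed

text \<open>The series for q = 1 converges only conditionally, so the step from q = 2 to q = 1 uses the locally uniform
remainder estimate instead of a summable majorant.\<close>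
lemma has_field_derivative_bern_fourier_2:
  assumes x: "x \<in> {0<..<1}"
  shows "(bern_fourier 2 has_real_derivative x - 1/2) (at x)"
proof -
  define \<delta> where "\<delta> = min x (1 - x) / 2"
  have \<delta>: "0 < \<delta>" "\<delta> < 1/2" using x by (auto simp: \<delta>_def)
  define C where "C = 1 / sin (pi * \<delta>) + 1 / (sin (pi * \<delta>))\<^sup>2"
  have bern_fourier_term_1: "bern_fourier_term 1 k t = - (sin (2 * pi * real (Suc k) * t) / (pi * real (Suc k)))" for k t
  proof -
    have "cos (2 * pi * real (Suc k) * t - real 1 * pi / 2) = sin (2 * pi * real (Suc k) * t)"
      using cos_diff[of _ "pi / 2"] by simp
    then show ?thesis by (simp add: bern_fourier_term_def)
  qed
  have part: "(\<Sum>k<N. bern_fourier_term 1 k t) = - (\<Sum>k=1..N. sin (2 * pi * real k * t) / (pi * real k))" for N t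
    unfolding bern_fourier_term_1 sum_negf by (simp add: sum.atLeast1_atMost_eq)
  have unif: "uniform_limit {\<delta>..1-\<delta>} (\<lambda>N t. \<Sum>k<N. bern_fourier_term 1 k t) (\<lambda>t. t - 1/2) sequentially"
  proof (rule uniform_limitI)
    fix e :: real assume e: "e > 0"
    have "(\<lambda>N. C / (2 * real N + 1)) \<longlonglongrightarrow> 0" by real_asymp
    then have "\<forall>\<^sub>F N in sequentially. C / (2 * real N + 1) < e"
      using e by (rule order_tendstoD)
    then show "\<forall>\<^sub>F N in sequentially. \<forall>t\<in>{\<delta>..1-\<delta>}. dist (\<Sum>k<N. bern_fourier_term 1 k t) (t - 1/2) < e"
    proof eventually_elim
      case (elim N)
      show ?case
      proof
        fix t assume t: "t \<in> {\<delta>..1-\<delta>}"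
        show "dist (\<Sum>k<N. bern_fourier_term 1 k t) (t - 1/2) < e"
          using sawtooth_remainder[OF \<delta> t, of N] elim unfolding part dist_real_def C_def by simp
      qed
    qed
  qed
  have interior: "x \<in> interior {\<delta>..1-\<delta>}" using x by (auto simp: \<delta>_def interior_atLeastAtMost_real min_def field_simps)
  have x': "x \<in> {\<delta>..1-\<delta>}" using interior x interior_subset by blast
  have "((\<lambda>x. \<Sum>k. bern_fourier_term 2 k x) has_real_derivative (\<Sum>k. bern_fourier_term 1 k x)) (at x)"
  proof (rule has_field_derivative_series'(2)[OF _ _ _ x' _ interior])
    show "uniformly_convergent_on {\<delta>..1-\<delta>} (\<lambda>n x. \<Sum>i<n. bern_fourier_term 1 i x)"
      using unif by (auto simp only: uniformly_convergent_on_def)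
    show "(bern_fourier_term 2 k has_real_derivative bern_fourier_term 1 k t) (at t within {\<delta>..1-\<delta>})" for k t
      using has_field_derivative_bern_fourier_term[of 1 k t] by (simp only: Suc_1)
    show "summable (\<lambda>k. bern_fourier_term 2 k x)" by (rule summable_bern_fourier_term) simp
  qed simp
  moreover have lim: "(\<lambda>N. \<Sum>k<N. bern_fourier_term 1 k x) \<longlonglongrightarrow> x - 1/2"
    by (rule tendsto_uniform_limitI[OF unif x'])
  moreover have "(\<Sum>k. bern_fourier_term 1 k x) = x - 1/2" using lim by (simp add: sums_def[symmetric] sums_iff)
  ultimately show ?thesis by (simp add: bern_fourier_def[abs_def])
qed

text \<open>Both sides have the same derivative by induction, so they differ by a constant d.  The difference D of the
next pair has derivative d and takes equal values at 0 and 1, hence d = 0.  No integral or special value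
has to be computed.\<close>
theorem bernpoly_eq_bern_fourier:
  assumes "q \<ge> 2" "x \<in> {0..1}"
  shows "bernpoly q x / fact q = bern_fourier q x"
proof -
  have bp: "((\<lambda>x. bernpoly (Suc q) x / fact (Suc q)) has_real_derivative bernpoly q x / fact q) (at x within S)" for q x S
    using DERIV_cdivide[OF has_field_derivative_bernpoly[of q x S], of "fact (Suc q)"] by (simp del: of_nat_Suc)
  have cb: "continuous_on {0..1} (\<lambda>x. bernpoly q x / fact q - bern_fourier q x)" if "q \<ge> 2" for q
    by (intro continuous_intros continuous_on_bern_fourier that) simp
  have *: "\<forall>x\<in>{0..1}. bernpoly q x / fact q = bern_fourier q x"
    if q: "q \<ge> 2" and der: "\<And>x. x \<in> {0<..<1} \<Longrightarrow> ((\<lambda>x. bernpoly q x / fact q - bern_fourier q x) has_real_derivative 0) (at x)" for q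
  proof -
    define d where "d x = bernpoly q x / fact q - bern_fourier q x" for x
    have const: "d x = d 0" if x: "x \<in> {0..1}" for x
    proof (rule DERIV_isconst2[where f = d and a = 0 and b = 1])
      show "continuous_on {0..1} d" unfolding d_def by (rule cb[OF q])
      show "(d has_real_derivative 0) (at x)" if "0 < x" "x < 1" for x
        unfolding d_def using that by (intro der) simp
    qed (use x in auto)
    define D where "D x = bernpoly (Suc q) x / fact (Suc q) - bern_fourier (Suc q) x" for x
    have "(D has_real_derivative d x) (at x within S)" for x S
      unfolding D_def d_def
      by (intro derivative_intros bp has_field_derivative_at_within[OF has_field_derivative_bern_fourier] q)
    then have "\<exists>z>0. z < 1 \<and> D 1 - D 0 = (1 - 0) * d z"
      by (intro MVT2) auto
    then obtain z where z: "0 < z" "z < 1" "D 1 - D 0 = d z" by auto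
    have "D 1 = D 0" using bern_fourier_plus_nat[of "Suc q" 0 1] q by (simp add: D_def bernpoly_at_1 bernoulli_def)
    then have "d 0 = 0" using z const[of z] by auto
    then show ?thesis using const by (auto simp: d_def)
  qed
  have "\<forall>x\<in>{0..1}. bernpoly q x / fact q = bern_fourier q x" using assms(1)
  proof (induction q rule: dec_induct)
    case base
    show ?case
    proof (rule *)
      fix x :: real assume x: "x \<in> {0<..<1}"
      have "((\<lambda>x. bernpoly 2 x / fact 2 - bern_fourier 2 x) has_real_derivative bernpoly 1 x / fact 1 - (x - 1/2)) (at x)"
        using bp[of 1 x UNIV] has_field_derivative_bern_fourier_2[OF x] 
        by (intro derivative_intros) (auto simp: numeral_2_eq_2)
      then show "((\<lambda>x. bernpoly 2 x / fact 2 - bern_fourier 2 x) has_real_derivative 0) (at x)"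
        by (simp only: bernpoly_1) simp
    qed simp
  next
    case (step q)
    show ?case
    proof (rule *)
      fix x :: real assume x: "x \<in> {0<..<1}"
      have "((\<lambda>x. bernpoly (Suc q) x / fact (Suc q) - bern_fourier (Suc q) x) has_real_derivative bernpoly q x / fact q - bern_fourier q x) (at x)"
        using step by (intro derivative_intros bp has_field_derivative_bern_fourier) auto
      then show "((\<lambda>x. bernpoly (Suc q) x / fact (Suc q) - bern_fourier (Suc q) x) has_real_derivative 0) (at x)"
        using step x by simp
    qed (use step in auto)
  qed
  then show ?thesis using assms by blast
qed

text \<open>At 0 the Fourier series of odd order is a series of sines of 0.\<close>
lemma bernoulli_odd: assumes "odd n" "n > 1" shows "bernoulli n = 0"
proof -
  obtain r where r: "n = 2 * r + 1" using assms by (elim oddE)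
  have "cos (0 - real n * pi / 2) = 0"
  proof -
    have "real n * pi / 2 = real r * pi + pi / 2" by (simp add: r field_simps)
    moreover have "cos (real r * pi + pi / 2) = 0" using cos_add[of "real r * pi" "pi / 2"] by simp
    ultimately show ?thesis by (simp only: cos_minus minus_diff_eq diff_0)
  qed
  then have "bern_fourier n 0 = 0" by (simp add: bern_fourier_def bern_fourier_term_def)
  moreover have "bernpoly n 0 / fact n = bern_fourier n 0" using assms by (intro bernpoly_eq_bern_fourier) auto
  ultimately show ?thesis by (simp add: bernoulli_def)
qed

section \<open>Mellin-type integrals of the periodic Bernoulli functions\<close>

text \<open>The integral of B_n({u}) u^(-c) over [m+1, m+2], moved to the unit interval, where the fractional part is t
itself and the integrand is smooth.\<close>
definition bern_piece :: "nat \<Rightarrow> complex \<Rightarrow> nat \<Rightarrow> complex" where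
  "bern_piece n c m = integral {0..1}
     (\<lambda>t. of_real (bernpoly n t) * of_real (real (Suc m) + t) powr (- c))"

text \<open>The integral of B_n({u}) u^(-c) over [1, \<infinity>).  As a series over unit intervals it converges absolutely for
Re c > 1, and conditionally for Re c > 0 if n \<ge> 1.\<close>
definition bern_tail :: "nat \<Rightarrow> complex \<Rightarrow> complex" where
  "bern_tail n c = (\<Sum>m. bern_piece n c m)"

lemma shifted_notin_nonpos_Reals:
  "t \<in> {0..1} \<Longrightarrow> of_real (real (Suc m) + t) \<notin> (\<real>\<^sub>\<le>\<^sub>0 :: complex set)"
  by (simp only: complex_nonpos_Reals_iff Re_complex_of_real) simp

lemma shifted_neq_0: "t \<in> {0..1} \<Longrightarrow> of_real (real (Suc m) + t) \<noteq> (0 :: complex)"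
  using shifted_notin_nonpos_Reals[of t m] by (auto simp del: of_real_add)

lemma continuous_on_shifted_powr:
  "continuous_on {0..1} (\<lambda>t. of_real (real (Suc m) + t) powr (- c) :: complex)"
  by (intro continuous_intros) (use shifted_neq_0 in \<open>auto simp del: of_real_add\<close>)

lemma integrable_bern_piece:
  "(\<lambda>t. of_real (bernpoly n t) * of_real (real (Suc m) + t) powr (- c) :: complex) integrable_on {0..1}"
  by (intro integrable_continuous_interval continuous_intros continuous_on_shifted_powr)

lemma norm_bern_piece_le:
  assumes K: "\<And>x. x \<in> {0..1} \<Longrightarrow> \<bar>bernpoly n x\<bar> \<le> K" and c: "Re c \<ge> \<sigma>" and "\<sigma> \<ge> 0"
  shows "norm (bern_piece n c m) \<le> K * real (Suc m) powr (- \<sigma>)"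
proof -
  have K0: "K \<ge> 0" using K[of 0] by auto
  have "norm (integral (cbox 0 1) (\<lambda>t. of_real (bernpoly n t) * of_real (real (Suc m) + t) powr (- c) :: complex))
      \<le> K * real (Suc m) powr (- \<sigma>) * measure lborel (cbox 0 (1::real))"
  proof (rule integrable_bound)
    fix t :: real assume t: "t \<in> cbox 0 1"
    have "norm (of_real (real (Suc m) + t) powr (- c) :: complex) = (real (Suc m) + t) powr (- Re c)"
      using t by (subst norm_powr_real_powr) auto
    also have "\<dots> \<le> real (Suc m) powr (- Re c)"
      using t c assms(3) by (intro powr_mono2') auto
    also have "\<dots> \<le> real (Suc m) powr (- \<sigma>)" using c by (intro powr_mono) auto
    finally show "norm (of_real (bernpoly n t) * of_real (real (Suc m) + t) powr (- c) :: complex) \<le> K * real (Suc m) powr (- \<sigma>)"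
      unfolding norm_mult using K[of t] t K0 by (intro mult_mono) auto
  qed (use K0 integrable_bern_piece in auto)
  then show ?thesis by (simp add: bern_piece_def)
qed

lemma summable_powr_Suc: "\<sigma> > 1 \<Longrightarrow> summable (\<lambda>m. K * real (Suc m) powr (- \<sigma>))"
  using summable_real_powr_iff[of "-\<sigma>"] by (intro summable_mult) (subst summable_Suc_iff[of "\<lambda>m. real m powr (- \<sigma>)"], simp)

lemma bern_piece_sums_of_Re_gt_1:
  assumes "Re c > 1" shows "bern_piece n c sums bern_tail n c"
proof -
  obtain K where K: "\<And>x. x \<in> {0..1} \<Longrightarrow> \<bar>bernpoly n x\<bar> \<le> K" using bernpoly_bounded by blast
  have "summable (bern_piece n c)"
    using summable_powr_Suc[OF assms] by (rule summable_comparison_test') (rule norm_bern_piece_le[OF K], use assms in auto)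
  then show ?thesis by (simp add: bern_tail_def summable_sums)
qed

lemma has_vector_derivative_shifted_powr:
  assumes "t \<in> {0..1}"
  shows "((\<lambda>t. of_real (real (Suc m) + t) powr (- c)) has_vector_derivative
     (- c) * (of_real (real (Suc m) + t) powr (- (c + 1)) :: complex)) (at t within S)"
proof -
  have "((\<lambda>z. (of_nat (Suc m) + z) powr (- c)) has_field_derivative (- c) * (of_nat (Suc m) + of_real t) powr (- (c + 1)))
      (at (of_real t))"
    using shifted_notin_nonpos_Reals[OF assms, of m] by (auto intro!: derivative_eq_intros)
  from has_vector_derivative_real_field[OF this] show ?thesis by (simp add: o_def)
qed

text \<open>Integration by parts on one unit interval, valid for every n; for n = 0 the two boundary values of B_1 have
opposite signs, which produces the trapezoidal rule in the Euler-Maclaurin formula.\<close>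
lemma bern_piece_by_parts:
  "of_real (bernpoly (Suc n) 1) * of_nat (Suc (Suc m)) powr (- c) - of_real (bernoulli (Suc n)) * of_nat (Suc m) powr (- c)
    = of_nat (Suc n) * bern_piece n c m - c * bern_piece (Suc n) (c + 1) m"
proof -
  let ?p = "\<lambda>t. of_real (real (Suc m) + t) powr (- c) :: complex"
  let ?q = "\<lambda>t. of_real (real (Suc m) + t) powr (- (c + 1)) :: complex"
  let ?f = "\<lambda>t. of_real (bernpoly (Suc n) t) * ?p t"
  have 1: "((\<lambda>t. of_nat (Suc n) * (of_real (bernpoly n t) * ?p t) - c * (of_real (bernpoly (Suc n) t) * ?q t))
      has_integral (?f 1 - ?f 0)) {0..1}"
  proof (rule fundamental_theorem_of_calculus)
    fix t :: real assume t: "t \<in> {0..1}"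
    have b: "((\<lambda>t. of_real (bernpoly (Suc n) t) :: complex) has_vector_derivative of_real (real (Suc n) * bernpoly n t)) (at t within {0..1})"
      by (intro has_vector_derivative_of_real has_field_derivative_bernpoly)
    show "(?f has_vector_derivative of_nat (Suc n) * (of_real (bernpoly n t) * ?p t) - c * (of_real (bernpoly (Suc n) t) * ?q t)) (at t within {0..1})"
      using has_vector_derivative_mult[OF b has_vector_derivative_shifted_powr[OF t, of m c]]
      by (rule has_vector_derivative_eq_rhs) (simp add: mult_ac)
  qed simp
  have 2: "((\<lambda>t. of_nat (Suc n) * (of_real (bernpoly n t) * ?p t) - c * (of_real (bernpoly (Suc n) t) * ?q t))
      has_integral (of_nat (Suc n) * bern_piece n c m - c * bern_piece (Suc n) (c + 1) m)) {0..1}"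
    unfolding bern_piece_def
    by (intro has_integral_diff has_integral_mult_right integrable_integral integrable_bern_piece)
  from has_integral_unique[OF 1 2] show ?thesis by (simp add: bernoulli_def add_ac)
qed

lemma powr_nat_to_0:
  assumes "Re c > 0" shows "(\<lambda>m. of_nat (Suc m) powr (- c) :: complex) \<longlonglongrightarrow> 0"
proof (rule tendsto_norm_zero_cancel)
  have "(\<lambda>m. real (Suc m) powr (- Re c)) \<longlonglongrightarrow> 0"
    using assms by real_asymp
  then show "(\<lambda>m. norm (of_nat (Suc m) powr (- c) :: complex)) \<longlonglongrightarrow> 0"
    by (subst norm_powr_real_powr) (auto simp del: of_nat_Suc)
qed

lemma telescope_powr_sums:
  assumes "Re c > 0" shows "(\<lambda>m. of_nat (Suc (Suc m)) powr (- c) - of_nat (Suc m) powr (- c)) sums (- 1 :: complex)"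
  using telescope_sums[OF powr_nat_to_0[OF assms]] by simp

text \<open>Summing the integration by parts over all unit intervals: as B_(n+1)(1) = B_(n+1)(0), the boundary terms telescope.
The index n+1 and exponent c+1 on the right give absolute convergence already for Re c > 0.\<close>
lemma bern_piece_sums:
  assumes n: "n \<ge> 1" and c: "Re c > 0"
  shows "bern_piece n c sums (- of_real (bernoulli (Suc n)) / of_nat (Suc n) + c / of_nat (Suc n) * bern_tail (Suc n) (c + 1))"
proof -
  have "(\<lambda>m. of_real (bernoulli (Suc n)) / of_nat (Suc n) * (of_nat (Suc (Suc m)) powr (- c) - of_nat (Suc m) powr (- c)) +
      c / of_nat (Suc n) * bern_piece (Suc n) (c + 1) m) sums
     (of_real (bernoulli (Suc n)) / of_nat (Suc n) * (-1) + c / of_nat (Suc n) * bern_tail (Suc n) (c + 1))"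
    using c by (intro sums_add sums_mult telescope_powr_sums bern_piece_sums_of_Re_gt_1) auto
  moreover have "of_real (bernoulli (Suc n)) / of_nat (Suc n) * (of_nat (Suc (Suc m)) powr (- c) - of_nat (Suc m) powr (- c)) +
      c / of_nat (Suc n) * bern_piece (Suc n) (c + 1) m = bern_piece n c m" for m
  proof -
    have "bernpoly (Suc n) 1 = bernoulli (Suc n)" using n by (simp add: bernpoly_at_1)
    with bern_piece_by_parts[of n m c]
    have "of_nat (Suc n) * bern_piece n c m = of_real (bernoulli (Suc n)) * (of_nat (Suc (Suc m)) powr (- c) - of_nat (Suc m) powr (- c)) +
        c * bern_piece (Suc n) (c + 1) m" by (simp add: algebra_simps)
    moreover have "of_nat (Suc n) \<noteq> (0::complex)" by (simp del: of_nat_Suc)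
    ultimately show ?thesis by (simp add: field_simps del: of_nat_Suc)
  qed
  ultimately show ?thesis by simp
qed

lemma bern_tail_Suc:
  assumes "n \<ge> 1" "Re c > 0"
  shows "bern_tail n c = - of_real (bernoulli (Suc n)) / of_nat (Suc n) + c / of_nat (Suc n) * bern_tail (Suc n) (c + 1)"
  using bern_piece_sums[OF assms] by (simp add: bern_tail_def sums_iff)

lemma holomorphic_bern_piece: "(\<lambda>c. bern_piece n c m) holomorphic_on S"
proof -
  have "(\<lambda>c. integral (cbox 0 1) (\<lambda>t. of_real (bernpoly n t) * of_real (real (Suc m) + t) powr (- c))) holomorphic_on UNIV"
  proof (rule leibniz_rule_holomorphic)
    fix c :: complex and t :: real assume t: "t \<in> cbox 0 1"
    have nz: "of_real (real (Suc m) + t) \<noteq> (0 :: complex)"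
      using shifted_neq_0[of t m] t by simp
    have "((\<lambda>c. of_real (real (Suc m) + t) powr (- c)) has_field_derivative
        - (of_real (real (Suc m) + t) powr (- c) * Ln (of_real (real (Suc m) + t)))) (at c within UNIV)"
      using DERIV_chain2[OF has_field_derivative_powr_right[OF nz] DERIV_minus[OF DERIV_ident]]
      by (simp add: mult_ac)
    from DERIV_cmult[OF this] show "((\<lambda>c. of_real (bernpoly n t) * of_real (real (Suc m) + t) powr (- c)) has_field_derivative
       of_real (bernpoly n t) * (- (of_real (real (Suc m) + t) powr (- c) * Ln (of_real (real (Suc m) + t))))) (at c within UNIV)" .
  next
    show "continuous_on (UNIV \<times> cbox 0 1) (\<lambda>(c, t). complex_of_real (bernpoly n t) *
        (- (of_real (real (Suc m) + t) powr (- c) * Ln (of_real (real (Suc m) + t)))))"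
      unfolding case_prod_unfold
      using shifted_notin_nonpos_Reals shifted_neq_0
      by (intro continuous_intros) (auto simp del: of_nat_Suc of_real_add)
  qed (use integrable_bern_piece in auto)
  then show ?thesis unfolding bern_piece_def cbox_interval by (rule holomorphic_on_subset) simp
qed

lemma holomorphic_bern_tail: "bern_tail n holomorphic_on {c. Re c > 1}"
proof (rule holomorphic_uniform_sequence)
  show "open {c. Re c > 1}" by (rule open_halfspace_Re_gt)
  show "(\<lambda>c. \<Sum>m<N. bern_piece n c m) holomorphic_on {c. Re c > 1}" for N
    by (intro holomorphic_on_sum holomorphic_bern_piece)
  fix c assume c: "c \<in> {c. Re c > 1}"
  define d where "d = (Re c - 1) / 2"
  have d: "d > 0" using c by (simp add: d_def)
  have sub: "Re z \<ge> 1 + d" if "z \<in> cball c d" for z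
    using that abs_Re_le_cmod[of "c - z"] by (auto simp: dist_norm d_def field_simps)
  obtain K where K: "\<And>x. x \<in> {0..1} \<Longrightarrow> \<bar>bernpoly n x\<bar> \<le> K" using bernpoly_bounded by blast
  have "uniform_limit (cball c d) (\<lambda>N c. \<Sum>m<N. bern_piece n c m) (\<lambda>c. \<Sum>m. bern_piece n c m) sequentially"
  proof (rule Weierstrass_m_test)
    show "summable (\<lambda>m. K * real (Suc m) powr (- (1 + d)))" using d by (intro summable_powr_Suc) auto
    show "norm (bern_piece n z m) \<le> K * real (Suc m) powr (- (1 + d))" if "z \<in> cball c d" for m z
      using d sub[OF that] by (intro norm_bern_piece_le K) auto
  qed
  then show "\<exists>d>0. cball c d \<subseteq> {c. Re c > 1} \<and> uniform_limit (cball c d) (\<lambda>N c. \<Sum>m<N. bern_piece n c m) (bern_tail n) sequentially"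
    using d sub unfolding bern_tail_def[abs_def] by (intro exI[of _ d] conjI) fastforce+
qed

section \<open>Analytic continuation of the zeta function\<close>

lemma bern_piece_0:
  assumes "s \<noteq> 1"
  shows "bern_piece 0 s m = - (of_nat (Suc (Suc m)) powr (- (s - 1)) - of_nat (Suc m) powr (- (s - 1))) / (s - 1)"
proof -
  let ?p = "\<lambda>t. of_real (real (Suc m) + t) powr (- (s - 1)) :: complex"
  have "((\<lambda>t. of_real (bernpoly 0 t) * of_real (real (Suc m) + t) powr (- s)) has_integral (?p 1 / (- (s - 1)) - ?p 0 / (- (s - 1)))) {0..1}"
  proof (rule fundamental_theorem_of_calculus)
    fix t :: real assume t: "t \<in> {0..1}"
    show "((\<lambda>t. ?p t / (- (s - 1))) has_vector_derivative of_real (bernpoly 0 t) * of_real (real (Suc m) + t) powr (- s)) (at t within {0..1})"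
      using has_vector_derivative_divide[OF has_vector_derivative_shifted_powr[OF t, of m "s - 1"], of "- (s - 1)"] assms
      by (simp add: bernpoly_0)
  qed simp
  from integral_unique[OF this] show ?thesis
    unfolding bern_piece_def
    by (simp only: divide_minus_right) (simp add: diff_divide_distrib)
qed

text \<open>The Euler-Maclaurin formula of first order for the Dirichlet series.\<close>
lemma Dirichlet_series_eq:
  assumes s: "Re s > 1"
  shows "(\<lambda>m. of_nat (Suc m) powr (- s)) sums (1 / (s - 1) + 1 / 2 - s * bern_tail 1 (s + 1))"
proof -
  have s1: "s \<noteq> 1" using s by auto
  have "(\<lambda>m. - (1 / (s - 1)) * (of_nat (Suc (Suc m)) powr (- (s - 1)) - of_nat (Suc m) powr (- (s - 1)))
      - 1 / 2 * (of_nat (Suc (Suc m)) powr (- s) - of_nat (Suc m) powr (- s))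
      - s * bern_piece 1 (s + 1) m) sums
    (- (1 / (s - 1)) * (-1) - 1 / 2 * (-1) - s * bern_tail 1 (s + 1))"
    using s by (intro sums_diff sums_mult telescope_powr_sums bern_piece_sums_of_Re_gt_1) auto
  moreover have "- (1 / (s - 1)) * (of_nat (Suc (Suc m)) powr (- (s - 1)) - of_nat (Suc m) powr (- (s - 1)))
      - 1 / 2 * (of_nat (Suc (Suc m)) powr (- s) - of_nat (Suc m) powr (- s))
      - s * bern_piece 1 (s + 1) m = of_nat (Suc m) powr (- s)" for m
  proof -
    have b1: "bernpoly (Suc 0) 1 = 1 / 2" "bernoulli (Suc 0) = - (1 / 2)"
      using bernpoly_1[of 1] bernoulli_1 by auto
    have "(1/2) * of_nat (Suc (Suc m)) powr (- s) + (1/2) * of_nat (Suc m) powr (- s)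
       = bern_piece 0 s m - s * bern_piece 1 (s + 1) m"
      using bern_piece_by_parts[of 0 m s] unfolding b1 by simp
    then have *: "(1/2) * of_nat (Suc (Suc m)) powr (- s) + (1/2) * of_nat (Suc m) powr (- s)
       = - (1 / (s - 1)) * (of_nat (Suc (Suc m)) powr (- (s - 1)) - of_nat (Suc m) powr (- (s - 1))) - s * bern_piece 1 (s + 1) m"
      unfolding bern_piece_0[OF s1] by (simp add: diff_divide_distrib)
    have "X - 1 / 2 * (C - D) - Y = D" if "(1/2) * C + (1/2) * D = X - Y" for X Y C D :: complex
    proof -
      have "X - 1 / 2 * (C - D) - Y = (X - Y) - 1 / 2 * (C - D)" by simp
      then show ?thesis unfolding that[symmetric] by (simp add: field_simps)
    qed
    from this[OF *] show ?thesis .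
  qed
  ultimately show ?thesis by simp
qed

text \<open>The continuation of \<open>bern_tail\<close> n by p formal integrations by parts.  The series that remains is
evaluated at c + p, so the domain of holomorphy grows to the left by p.\<close>
fun bern_tail_cont :: "nat \<Rightarrow> nat \<Rightarrow> complex \<Rightarrow> complex" where
  "bern_tail_cont 0 n c = bern_tail n c"
| "bern_tail_cont (Suc p) n c = - of_real (bernoulli (Suc n)) / of_nat (Suc n) + c / of_nat (Suc n) * bern_tail_cont p (Suc n) (c + 1)"

lemma bern_tail_cont_Suc_eq:
  "n \<ge> 1 \<Longrightarrow> Re c > - real p \<Longrightarrow> bern_tail_cont (Suc p) n c = bern_tail_cont p n c"
proof (induction p arbitrary: n c)
  case 0
  then show ?case using bern_tail_Suc[of n c] by simp
next
  case (Suc p)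
  have "bern_tail_cont (Suc (Suc p)) n c = - of_real (bernoulli (Suc n)) / of_nat (Suc n) + c / of_nat (Suc n) * bern_tail_cont (Suc p) (Suc n) (c + 1)"
    by (rule bern_tail_cont.simps)
  also have "bern_tail_cont (Suc p) (Suc n) (c + 1) = bern_tail_cont p (Suc n) (c + 1)"
    using Suc.prems by (intro Suc.IH) auto
  finally show ?case by simp
qed

lemma bern_tail_cont_eq:
  assumes "n \<ge> 1" "p \<le> q" "Re c > - real p"
  shows "bern_tail_cont q n c = bern_tail_cont p n c"
  using assms(2)
proof (induction q rule: dec_induct)
  case (step q)
  then show ?case using assms by (subst bern_tail_cont_Suc_eq) auto
qed simp

lemma holomorphic_bern_tail_cont: "bern_tail_cont p n holomorphic_on {c. Re c > 1 - real p}"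
proof (induction p arbitrary: n)
  case 0
  then show ?case using holomorphic_bern_tail[of n] by (simp cong: holomorphic_cong)
next
  case (Suc p)
  have "(bern_tail_cont p (Suc n) \<circ> (\<lambda>c. c + 1)) holomorphic_on {c. Re c > 1 - real (Suc p)}"
    by (rule holomorphic_on_compose_gen[OF _ Suc.IH]) (auto intro!: holomorphic_intros)
  then have "(\<lambda>c. bern_tail_cont p (Suc n) (c + 1)) holomorphic_on {c. Re c > 1 - real (Suc p)}"
    by (simp add: o_def)
  then show ?case by (simp only: bern_tail_cont.simps) (intro holomorphic_intros, auto simp del: of_nat_Suc)
qed

text \<open>The Euler-Maclaurin formula after p integrations by parts of its remainder; it is meaningful for Re s > -p.\<close>
definition zeta_ext :: "nat \<Rightarrow> complex \<Rightarrow> complex" where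
  "zeta_ext p s = 1 / (s - 1) + 1 / 2 - s * bern_tail_cont p 1 (s + 1)"

lemma zeta_ext_eq: "p \<le> q \<Longrightarrow> Re s > - 1 - real p \<Longrightarrow> zeta_ext q s = zeta_ext p s"
  unfolding zeta_ext_def by (subst bern_tail_cont_eq[of 1 p q]) auto

lemma holomorphic_zeta_ext: "zeta_ext p holomorphic_on {s. Re s > - real p} - {1}"
proof -
  have "(bern_tail_cont p 1 \<circ> (\<lambda>s. s + 1)) holomorphic_on {s. Re s > - real p} - {1}"
    by (rule holomorphic_on_compose_gen[OF _ holomorphic_bern_tail_cont]) (auto intro!: holomorphic_intros)
  then have "(\<lambda>s. bern_tail_cont p 1 (s + 1)) holomorphic_on {s. Re s > - real p} - {1}"
    by (simp add: o_def)
  then show ?thesis unfolding zeta_ext_def[abs_def] by (intro holomorphic_intros) auto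
qed

text \<open>The functions \<open>zeta_ext\<close> p agree where two of them are meaningful, so they glue to one holomorphic function:
at s any sufficiently large p may be chosen.\<close>
lemma zeta_exists:
  "\<exists>f. f holomorphic_on - {1} \<and> (\<forall>s. Re s > 1 \<longrightarrow> (\<lambda>n. of_nat (Suc n) powr (- s)) sums f s) \<and>
       (\<forall>p s. Re s > - real p \<longrightarrow> f s = zeta_ext p s)"
proof -
  define f where "f s = zeta_ext (nat \<lceil>1 - Re s\<rceil>) s" for s
  have eq: "f s = zeta_ext p s" if s: "Re s > - real p" for p s
  proof -
    let ?q = "nat \<lceil>1 - Re s\<rceil>"
    have q: "Re s > - real ?q" by linarith
    have "zeta_ext (max p ?q) s = zeta_ext ?q s" "zeta_ext (max p ?q) s = zeta_ext p s"
      using q s by (auto intro!: zeta_ext_eq)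
    then show ?thesis by (simp add: f_def)
  qed
  have "f holomorphic_on - {1}"
    unfolding holomorphic_on_def
  proof
    fix s :: complex assume s: "s \<in> - {1}"
    define p where "p = nat \<lceil>1 - Re s\<rceil>"
    have p: "Re s > - real p" unfolding p_def by linarith
    have op: "open ({s. Re s > - real p} - {1})" by (intro open_Diff open_halfspace_Re_gt) auto
    have "f holomorphic_on {s. Re s > - real p} - {1}"
      using holomorphic_zeta_ext[of p] by (rule holomorphic_transform) (auto simp: eq)
    then have "f field_differentiable at s" using op s p by (intro holomorphic_on_imp_differentiable_at) auto
    then show "f field_differentiable at s within - {1}" by (rule field_differentiable_at_within)
  qed
  moreover have "(\<lambda>n. of_nat (Suc n) powr (- s)) sums f s" if s: "Re s > 1" for s
    using Dirichlet_series_eq[OF s] s by (simp add: eq[of 0 s] zeta_ext_def)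
  ultimately show ?thesis using eq by blast
qed

lemma zeta_spec:
  "zeta holomorphic_on - {1}"
  "\<And>s. Re s > 1 \<Longrightarrow> (\<lambda>n. of_nat (Suc n) powr (- s)) sums zeta s"
proof -
  have "\<exists>f. f holomorphic_on - {1} \<and> (\<forall>s. Re s > 1 \<longrightarrow> (\<lambda>n. of_nat (Suc n) powr (- s)) sums f s)"
    using zeta_exists by blast
  from someI_ex[OF this] show "zeta holomorphic_on - {1}"
      "\<And>s. Re s > 1 \<Longrightarrow> (\<lambda>n. of_nat (Suc n) powr (- s)) sums zeta s"
    unfolding zeta_def[symmetric] by blast+
qed

text \<open>By the identity theorem, whichever continuation the choice operator picks is the one constructed from
integration by parts.\<close>
theorem zeta_eq_zeta_ext:
  assumes "Re s > - real p" "s \<noteq> 1" shows "zeta s = zeta_ext p s"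
proof -
  obtain f where f: "f holomorphic_on - {1}" "\<And>s. Re s > 1 \<Longrightarrow> (\<lambda>n. of_nat (Suc n) powr (- s)) sums f s"
      "\<And>p s. Re s > - real p \<Longrightarrow> f s = zeta_ext p s" using zeta_exists by blast
  have "zeta s = f s"
  proof (rule analytic_continuation_open[where s = "{s. Re s > 1}" and s' = "- {1}" and f = zeta and g = f])
    show "connected (- {1::complex})" by (intro connected_open_delete_finite[of UNIV "{1}", folded Compl_eq_Diff_UNIV]) auto
    show "{s :: complex. Re s > 1} \<noteq> {}" by (auto intro!: exI[of _ 2])
    show "zeta z = f z" if "z \<in> {s. Re s > 1}" for z
      using zeta_spec(2)[of z] f(2)[of z] that by (auto dest: sums_unique2)
  qed (use zeta_spec f(1) assms in \<open>auto intro: open_halfspace_Re_gt\<close>)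
  then show ?thesis using f(3) assms by simp
qed

section \<open>The integrals J and their recurrence\<close>

lemma bern_piece_of_nat:
  "bern_piece n (of_nat j) m = of_real (integral {0..1} (\<lambda>t. bernpoly n t / (real (Suc m) + t) ^ j))"
proof -
  have "(\<lambda>t. bernpoly n t / (real (Suc m) + t) ^ j) integrable_on {0..1}"
    by (intro integrable_continuous_interval continuous_intros) auto
  then have "((\<lambda>t. of_real (bernpoly n t / (real (Suc m) + t) ^ j)) has_integral
      (of_real (integral {0..1} (\<lambda>t. bernpoly n t / (real (Suc m) + t) ^ j)) :: complex)) {0..1}"
    by (intro has_integral_of_real integrable_integral)
  then have "((\<lambda>t. of_real (bernpoly n t) * of_real (real (Suc m) + t) powr (- of_nat j)) has_integral
      (of_real (integral {0..1} (\<lambda>t. bernpoly n t / (real (Suc m) + t) ^ j)) :: complex)) {0..1}"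
  proof (rule has_integral_eq[rotated])
    fix t :: real assume t: "t \<in> {0..1}"
    have "of_real (real (Suc m) + t) powr (- of_nat j) = inverse (of_real (real (Suc m) + t) ^ j :: complex)"
      using shifted_neq_0[OF t, of m] by (simp only: powr_minus powr_nat if_False)
    then show "of_real (bernpoly n t / (real (Suc m) + t) ^ j) = of_real (bernpoly n t) * (of_real (real (Suc m) + t) powr (- of_nat j) :: complex)"
      by (simp add: divide_inverse del: of_nat_Suc)
  qed
  then show ?thesis unfolding bern_piece_def by (rule integral_unique)
qed

text \<open>The substitution t = 1/x - (m+1) reverses the orientation.  At the left end point t = 1 while the fractional
part of 1/x is 0, so that one point is discarded.\<close>
lemma has_integral_J_piece:
  "((\<lambda>x. x ^ k * bernpoly n (frac (1 / x))) has_integral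
     integral {0..1} (\<lambda>t. bernpoly n t / (real (Suc m) + t) ^ (k + 2))) {1 / real (Suc (Suc m))..1 / real (Suc m)}"
proof -
  define M where "M = real (Suc m)"
  have M: "M > 0" by (simp add: M_def)
  define F where "F t = - (bernpoly n t / (M + t) ^ (k + 2))" for t
  define a b where "a = 1 / (M + 1)" and "b = 1 / M"
  have ab: "0 < a" "a \<le> b" using M by (auto simp: a_def b_def field_simps)
  have ga: "1 / a - M = 1" "1 / b - M = 0" using M by (auto simp: a_def b_def)
  have sub: "1 / x - M \<in> {0..1}" if "x \<in> {a..b}" for x
  proof -
    have "1 / b \<le> 1 / x" "1 / x \<le> 1 / a" using that ab by (auto intro!: divide_left_mono mult_pos_pos)
    with ga show ?thesis by simp
  qed
  have "((\<lambda>x. (- 1 / x\<^sup>2) *\<^sub>R F (1 / x - M)) has_integral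
      (integral {1 / a - M..1 / b - M} F - integral {1 / b - M..1 / a - M} F)) {a..b}"
  proof (rule has_integral_substitution_general[where s = "{}"])
    show "(\<lambda>x. 1 / x - M) ` {a..b} \<subseteq> {0..1}" using sub by auto
    show "continuous_on {0..1} F" unfolding F_def using M by (intro continuous_intros) auto
    show "continuous_on {a..b} (\<lambda>x. 1 / x - M)" using ab by (intro continuous_intros) auto
    show "((\<lambda>x. 1 / x - M) has_real_derivative - 1 / x\<^sup>2) (at x within {a..b})" if "x \<in> {a..b} - {}" for x
      using that ab by (auto intro!: derivative_eq_intros simp: power2_eq_square)
  qed (use ab in auto)
  then have "((\<lambda>x. (- 1 / x\<^sup>2) *\<^sub>R F (1 / x - M)) has_integral integral {0..1} (\<lambda>t. bernpoly n t / (M + t) ^ (k + 2))) {a..b}"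
    unfolding ga F_def by (simp only: integral_neg) simp
  then have "((\<lambda>x. x ^ k * bernpoly n (frac (1 / x))) has_integral integral {0..1} (\<lambda>t. bernpoly n t / (M + t) ^ (k + 2))) {a..b}"
  proof (rule has_integral_spike_finite[of "{a}", rotated 2])
    fix x assume x: "x \<in> {a..b} - {a}"
    then have x0: "x > 0" and xa: "x > a" "x \<le> b" using ab by auto
    have "1 / x - M < 1" "1 / x - M \<ge> 0" using x0 xa M by (auto simp: a_def b_def field_simps)
    then have "frac (1 / x) = 1 / x - M"
      by (intro frac_unique_iff[THEN iffD2]) (auto simp: M_def)
    then show "x ^ k * bernpoly n (frac (1 / x)) = (- 1 / x\<^sup>2) *\<^sub>R F (1 / x - M)"
      using x0 by (simp add: F_def power_add power_divide power2_eq_square)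
  qed simp
  then show ?thesis by (simp add: a_def b_def M_def add_ac)
qed

text \<open>The integrand may jump at every 1/N, and these points accumulate at 0.  It is bounded, however, so dominated
convergence gives the integral as the limit of the integrals over [1/(N+1), 1].\<close>
lemma J_sums:
  "(\<lambda>m. integral {0..1} (\<lambda>t. bernpoly n t / (real (Suc m) + t) ^ (k + 2))) sums J k n"
proof -
  define f where "f x = x ^ k * bernpoly n (frac (1 / x))" for x
  define r where "r m = integral {0..1} (\<lambda>t. bernpoly n t / (real (Suc m) + t) ^ (k + 2))" for m
  obtain K where K: "K > 0" "\<And>x. x \<in> {0..1} \<Longrightarrow> \<bar>bernpoly n x\<bar> \<le> K" using bernpoly_bounded by blast
  have part: "(f has_integral (\<Sum>m<N. r m)) {1 / real (Suc N)..1}" for N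
  proof (induction N)
    case (Suc N)
    have "(f has_integral (r N + (\<Sum>m<N. r m))) {1 / real (Suc (Suc N))..1}"
    proof (rule has_integral_combine)
      show "(f has_integral r N) {1 / real (Suc (Suc N))..1 / real (Suc N)}"
        unfolding f_def[abs_def] r_def by (rule has_integral_J_piece)
    qed (use Suc in \<open>auto simp: field_simps\<close>)
    then show ?case by (simp add: add_ac)
  qed auto
  define F where "F N x = (if x \<in> {1 / real (Suc N)..1} then f x else 0)" for N x
  have hF: "(F N has_integral (\<Sum>m<N. r m)) {0..1}" for N
    using part[of N] unfolding F_def[abs_def] by (subst has_integral_restrict) (auto simp: field_simps)
  have "(\<lambda>N. integral {0..1} (F N)) \<longlonglongrightarrow> integral {0..1} (\<lambda>x. if x = 0 then 0 else f x)"
  proof (rule dominated_convergence(2))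
    show "F N integrable_on {0..1}" for N using hF by (auto simp: integrable_on_def)
    show "(\<lambda>x. K) integrable_on {0..1::real}" by (rule integrable_const_ivl)
    show "norm (F N x) \<le> K" if x: "x \<in> {0..1}" for N x
    proof -
      have "\<bar>x ^ k\<bar> * \<bar>bernpoly n (frac (1 / x))\<bar> \<le> 1 * K"
        using x K(1) frac_ge_0[of "1/x"] frac_lt_1[of "1/x"] by (intro mult_mono K(2)) (auto simp: power_le_one)
      then show ?thesis using K(1) by (simp add: F_def f_def abs_mult)
    qed
    show "(\<lambda>N. F N x) \<longlonglongrightarrow> (if x = 0 then 0 else f x)" if x: "x \<in> {0..1}" for x
    proof (cases "x = 0")
      case True
      then show ?thesis by (simp add: F_def)
    next
      case False
      have "(\<lambda>N. 1 / real (Suc N)) \<longlonglongrightarrow> 0" by real_asymp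
      then have "\<forall>\<^sub>F N in sequentially. 1 / real (Suc N) < x" by (rule order_tendstoD) (use x False in auto)
      then have "\<forall>\<^sub>F N in sequentially. F N x = f x" by eventually_elim (use x in \<open>auto simp: F_def\<close>)
      then show ?thesis using False by (simp add: tendsto_eventually)
    qed
  qed
  moreover have "integral {0..1} (\<lambda>x. if x = 0 then 0 else f x) = integral {0..1} f"
    by (rule integral_spike[of "{0}"]) auto
  ultimately have "(\<lambda>N. \<Sum>m<N. r m) \<longlonglongrightarrow> integral {0..1} f"
    using integral_unique[OF hF] by simp
  then show ?thesis by (simp add: sums_def r_def J_def f_def[abs_def])
qed

lemma J_eq_bern_tail: "of_real (J k n) = bern_tail n (of_nat (k + 2))"
proof -
  have "(\<lambda>m. bern_piece n (of_nat (k + 2)) m) sums of_real (J k n)"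
    unfolding bern_piece_of_nat by (intro sums_of_real J_sums)
  then show ?thesis unfolding bern_tail_def by (rule sums_unique)
qed

lemma J_recurrence:
  assumes "n \<ge> 1"
  shows "real (k + 2) * J (Suc k) (Suc n) = bernoulli (Suc n) + real (Suc n) * J k n"
proof -
  have eq: "bern_tail n (of_nat (k + 2)) = - of_real (bernoulli (Suc n)) / of_nat (Suc n) +
     of_nat (k + 2) / of_nat (Suc n) * bern_tail (Suc n) (of_nat (Suc k + 2))"
    using bern_tail_Suc[OF assms, of "of_nat (k + 2)"] by (simp add: add_ac)
  have "complex_of_real (J k n) = of_real (- bernoulli (Suc n) / real (Suc n) + real (k + 2) / real (Suc n) * J (Suc k) (Suc n))"
    using eq unfolding J_eq_bern_tail[symmetric] by (simp del: of_nat_Suc of_nat_add)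
  then have "J k n = - bernoulli (Suc n) / real (Suc n) + real (k + 2) / real (Suc n) * J (Suc k) (Suc n)"
    by (simp only: of_real_eq_iff)
  then have "real (Suc n) * J k n = - bernoulli (Suc n) + real (k + 2) * J (Suc k) (Suc n)"
    by (simp add: right_diff_distrib del: of_nat_Suc)
  then show ?thesis by simp
qed

text \<open>Each unit interval contributes ln(m+2) - ln(m+1) minus a trapezoidal term, and the latter add up to a harmonic
number and a boundary correction.\<close>
lemma J_0_1: "J 0 1 = 1 / 2 - euler_mascheroni"
proof -
  define G where "G u = ln u + 1 / (2 * u)" for u :: real
  have piece: "integral {0..1} (\<lambda>t. bernpoly 1 t / (real (Suc m) + t) ^ (0 + 2)) =
     ln (real (Suc (Suc m))) - ln (real (Suc m)) - (1 / real (Suc m) + 1 / real (Suc (Suc m))) / 2" for m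
  proof -
    define M where "M = real (Suc m)"
    have M: "M > 0" by (simp add: M_def)
    have "((\<lambda>t. bernpoly 1 t / (M + t) ^ 2) has_integral
       ((ln (M + 1) + (M + 1/2) / (M + 1)) - (ln (M + 0) + (M + 1/2) / (M + 0)))) {0..1}"
    proof (rule fundamental_theorem_of_calculus)
      fix t :: real assume t: "t \<in> {0..1}"
      have "((\<lambda>t. ln (M + t) + C / (M + t)) has_real_derivative (1 / (M + t) - C / (M + t)\<^sup>2)) (at t within {0..1})" for C
        using t M by (auto intro!: derivative_eq_intros simp: power2_eq_square)
      note this[of "M + 1/2"]
      moreover have "1 / (M + t) - (M + 1/2) / (M + t)\<^sup>2 = bernpoly 1 t / (M + t)\<^sup>2"
        using t M unfolding bernpoly_1 by (simp add: divide_simps power2_eq_square)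
      ultimately show "((\<lambda>t. ln (M + t) + (M + 1/2) / (M + t)) has_vector_derivative bernpoly 1 t / (M + t)\<^sup>2) (at t within {0..1})"
        by (simp add: has_real_derivative_iff_has_vector_derivative)
    qed simp
    then have "integral {0..1} (\<lambda>t. bernpoly 1 t / (M + t) ^ 2) = ln (M + 1) - ln M + ((M + 1/2) / (M + 1) - (M + 1/2) / M)"
      by (simp add: integral_unique)
    also have "(M + 1/2) / (M + 1) - (M + 1/2) / M = - (1 / M + 1 / (M + 1)) / 2"
      using M by (simp add: divide_simps) (simp add: algebra_simps)
    finally have *: "integral {0..1} (\<lambda>t. bernpoly 1 t / (M + t) ^ 2) = ln (M + 1) - ln M + - (1 / M + 1 / (M + 1)) / 2" .
    have S: "real (Suc (Suc m)) = M + 1" by (simp add: M_def)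
    show ?thesis unfolding S M_def[symmetric] add_0 * by (simp add: field_simps)
  qed
  have sum: "(\<Sum>m<N. integral {0..1} (\<lambda>t. bernpoly 1 t / (real (Suc m) + t) ^ (0 + 2))) =
     1 / 2 - (harm N - ln (real (Suc N)) + 1 / (2 * real (Suc N)))" for N
  proof (induction N)
    case 0
    show ?case by (simp add: harm_def)
  next
    case (Suc N)
    have "1 / 2 - (h - a + 1 / (2 * x)) + (b - a - (1 / x + 1 / y) / 2) = 1 / 2 - (h + inverse x - b + 1 / (2 * y))"
      for h a b x y :: real by (simp add: inverse_eq_divide add_divide_distrib)
    then show ?case unfolding sum.lessThan_Suc Suc.IH unfolding piece harm_Suc by this
  qed
  have "(\<lambda>N. harm N - ln (real (Suc N))) \<longlonglongrightarrow> euler_mascheroni"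
  proof -
    have "(\<lambda>N. ln (real (Suc N)) - ln (real N)) \<longlonglongrightarrow> 0" by real_asymp
    from tendsto_diff[OF euler_mascheroni_LIMSEQ this] show ?thesis by simp
  qed
  moreover have "(\<lambda>N. 1 / (2 * real (Suc N))) \<longlonglongrightarrow> 0" by real_asymp
  ultimately have "(\<lambda>N. 1 / 2 - (harm N - ln (real (Suc N)) + 1 / (2 * real (Suc N)))) \<longlonglongrightarrow> 1 / 2 - (euler_mascheroni + 0)"
    by (intro tendsto_intros)
  then have "(\<lambda>m. integral {0..1} (\<lambda>t. bernpoly 1 t / (real (Suc m) + t) ^ (0 + 2))) sums (1 / 2 - euler_mascheroni)"
    unfolding sums_def sum by simp
  then show ?thesis using J_sums[of 1 0] sums_unique2 by blast
qed

section \<open>The zeta derivative at non-positive even integers\<close>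

text \<open>The integral of B_n over [0, 1] vanishes for n \<ge> 1.\<close>
lemma sum_binomial_bernoulli_over_Suc:
  assumes "n \<ge> 1"
  shows "(\<Sum>k\<le>n. real (n choose k) * bernoulli (n - k) / real (Suc k)) = 0"
proof -
  have "real (Suc n) * (\<Sum>k\<le>n. real (n choose k) * bernoulli (n - k) / real (Suc k)) =
      (\<Sum>k\<le>n. real (Suc n choose Suc k) * bernoulli (n - k))"
    unfolding sum_distrib_left
  proof (rule sum.cong)
    fix k
    have "real (Suc k) * real (Suc n choose Suc k) = real (Suc n) * real (n choose k)"
      using Suc_times_binomial[of k n] by (simp only: of_nat_mult[symmetric])
    then have "real (Suc n choose Suc k) = real (Suc n) * real (n choose k) / real (Suc k)"
      by (simp add: eq_divide_eq mult.commute del: of_nat_Suc)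
    then show "real (Suc n) * (real (n choose k) * bernoulli (n - k) / real (Suc k)) = real (Suc n choose Suc k) * bernoulli (n - k)"
      by (simp only: times_divide_eq_left times_divide_eq_right mult.assoc)
  qed simp
  also have "\<dots> = (\<Sum>k=1..Suc n. real (Suc n choose k) * bernoulli (Suc n - k))"
    by (rule sum.reindex_bij_witness[of _ "\<lambda>k. k - 1" Suc]) auto
  also have "\<dots> = 0" using assms sum_binomial_bernoulli[of "Suc n"] by simp
  finally show ?thesis by (simp del: of_nat_Suc)
qed

text \<open>The finite sum from the definition of b at level p, obtained from level p+1 by splitting
(p+1 choose k+1) / k into (p+1) (p choose k) (1/k - 1/(k+1)).  Both parities of the index need this conversion,
since their computations naturally end with the left-hand side.\<close>
lemma sum_binomial_bernoulli_over_pred: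
  assumes "p \<ge> 1"
  shows "(\<Sum>k=2..Suc p. real (Suc p choose k) * bernoulli (Suc p - k) / real (k - 1)) =
     real (Suc p) * ((\<Sum>k=1..p. real (p choose k) * bernoulli (p - k) / real k) + bernoulli p)"
proof -
  have "(\<Sum>k=2..Suc p. real (Suc p choose k) * bernoulli (Suc p - k) / real (k - 1)) =
      (\<Sum>k=1..p. real (Suc p choose Suc k) * bernoulli (p - k) / real k)"
    by (rule sum.reindex_bij_witness[of _ Suc "\<lambda>k. k - 1"]) auto
  also have "\<dots> = (\<Sum>k=1..p. real (Suc p) * (real (p choose k) * bernoulli (p - k) / real k - real (p choose k) * bernoulli (p - k) / real (Suc k)))"
  proof (rule sum.cong)
    fix k assume k: "k \<in> {1..p}"
    define B where "B = bernoulli (p - k)"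
    have "real (Suc k) * real (Suc p choose Suc k) = real (Suc p) * real (p choose k)"
      using Suc_times_binomial[of k p] by (simp only: of_nat_mult[symmetric])
    then have *: "real (Suc p choose Suc k) = real (Suc p) * real (p choose k) / real (Suc k)"
      by (simp add: eq_divide_eq mult.commute del: of_nat_Suc)
    have "X * C / (y + 1) * B / y = X * (C * B / y - C * B / (y + 1))" if "y > 0" for X C y :: real
      using that by (simp add: field_simps)
    from this[of "real k" "real (Suc p)" "real (p choose k)"] k
    show "real (Suc p choose Suc k) * bernoulli (p - k) / real k =
       real (Suc p) * (real (p choose k) * bernoulli (p - k) / real k - real (p choose k) * bernoulli (p - k) / real (Suc k))"
      unfolding * B_def[symmetric] by (simp add: add.commute)
  qed simp
  also have "\<dots> = real (Suc p) * ((\<Sum>k=1..p. real (p choose k) * bernoulli (p - k) / real k) -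
       (\<Sum>k=1..p. real (p choose k) * bernoulli (p - k) / real (Suc k)))"
    by (simp only: sum_distrib_left[symmetric] sum_subtractf)
  also have "(\<Sum>k=1..p. real (p choose k) * bernoulli (p - k) / real (Suc k)) = - bernoulli p"
  proof -
    have "0 = (\<Sum>k=0..p. real (p choose k) * bernoulli (p - k) / real (Suc k))"
      using sum_binomial_bernoulli_over_Suc[OF assms] by (simp add: atMost_atLeast0)
    also have "\<dots> = bernoulli p + (\<Sum>k=1..p. real (p choose k) * bernoulli (p - k) / real (Suc k))"
      by (subst sum.atLeast_Suc_atMost) auto
    finally show ?thesis by simp
  qed
  finally show ?thesis by simp
qed

text \<open>The integral of B_n(u) u^(-c) over [0, 1], evaluated termwise as if every power were integrable there.\<close>
definition bern_head :: "nat \<Rightarrow> complex \<Rightarrow> complex" where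
  "bern_head n c = (\<Sum>k\<le>n. of_real (real (n choose k) * bernoulli (n - k)) / (of_nat (Suc k) - c))"

text \<open>The formal integrals over [0, 1] satisfy the recurrence of \<open>bern_tail\<close> with the opposite boundary term.  In the
sum of head and tail the boundary terms therefore cancel.\<close>
lemma bern_head_step:
  assumes n: "n \<ge> 1" and c: "c \<notin> \<int>"
  shows "bern_head n c - of_real (bernoulli (Suc n)) / of_nat (Suc n) = c / of_nat (Suc n) * bern_head (Suc n) (c + 1)"
proof -
  have c0: "c \<noteq> 0" "of_nat k - c \<noteq> 0" for k using c by (auto simp: algebra_simps)
  have "c / of_nat (Suc n) * bern_head (Suc n) (c + 1) =
     c / of_nat (Suc n) * (\<Sum>k\<le>Suc n. of_real (real (Suc n choose k) * bernoulli (Suc n - k)) / (of_nat k - c))"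
    by (simp add: bern_head_def)
  also have "(\<Sum>k\<le>Suc n. of_real (real (Suc n choose k) * bernoulli (Suc n - k)) / (of_nat k - c)) =
     - of_real (bernoulli (Suc n)) / c + (\<Sum>k\<le>n. of_real (real (Suc n choose Suc k) * bernoulli (n - k)) / (of_nat (Suc k) - c))"
    by (subst sum.atMost_Suc_shift) simp
  also have "c / of_nat (Suc n) * \<dots> = - of_real (bernoulli (Suc n)) / of_nat (Suc n) +
     (\<Sum>k\<le>n. c / of_nat (Suc n) * (of_real (real (Suc n choose Suc k) * bernoulli (n - k)) / (of_nat (Suc k) - c)))"
  proof -
    have "c / of_nat (Suc n) * (- of_real (bernoulli (Suc n)) / c) = - of_real (bernoulli (Suc n)) / of_nat (Suc n)"
      using c0(1) by (simp del: of_nat_Suc)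
    then show ?thesis by (simp only: distrib_left sum_distrib_left)
  qed
  also have "(\<Sum>k\<le>n. c / of_nat (Suc n) * (of_real (real (Suc n choose Suc k) * bernoulli (n - k)) / (of_nat (Suc k) - c)))
     = (\<Sum>k\<le>n. of_real (real (n choose k) * bernoulli (n - k)) / (of_nat (Suc k) - c) -
          of_real (real (n choose k) * bernoulli (n - k) / real (Suc k)))"
  proof (rule sum.cong)
    fix k
    have "real (Suc k) * real (Suc n choose Suc k) = real (Suc n) * real (n choose k)"
      using Suc_times_binomial[of k n] by (simp only: of_nat_mult[symmetric])
    then have *: "real (Suc n choose Suc k) = real (Suc n) * real (n choose k) / real (Suc k)"
      by (simp add: eq_divide_eq mult.commute del: of_nat_Suc)
    have "c / N * ((N * C / K * B) / (K - c)) = C * B / (K - c) - C * B / K"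
      if "K - c \<noteq> 0" "N \<noteq> 0" "K \<noteq> 0" for C B K N :: complex
      using that by (simp add: field_simps)
    from this[of "of_nat (Suc k)" "of_nat (Suc n)" "of_nat (n choose k)" "of_real (bernoulli (n - k))"]
    show "c / of_nat (Suc n) * (of_real (real (Suc n choose Suc k) * bernoulli (n - k)) / (of_nat (Suc k) - c))
      = of_real (real (n choose k) * bernoulli (n - k)) / (of_nat (Suc k) - c) -
          of_real (real (n choose k) * bernoulli (n - k) / real (Suc k))"
      unfolding * using c0(2)[of "Suc k"] by (simp del: of_nat_Suc)
  qed simp
  also have "\<dots> = bern_head n c - of_real (\<Sum>k\<le>n. real (n choose k) * bernoulli (n - k) / real (Suc k))"
    by (simp only: sum_subtractf bern_head_def of_real_sum)
  also have "\<dots> = bern_head n c"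
    using sum_binomial_bernoulli_over_Suc[OF n] by simp
  finally show ?thesis by simp
qed

text \<open>Iterating the homogeneous recurrence of head plus tail produces a Pochhammer symbol.\<close>
lemma bern_head_add_tail_cont:
  assumes "n \<ge> 1" "c \<notin> \<int>"
  shows "bern_head n c + bern_tail_cont p n c =
     pochhammer c p * (fact n / fact (n + p)) * (bern_head (n + p) (c + of_nat p) + bern_tail (n + p) (c + of_nat p))"
  using assms
proof (induction p arbitrary: n c)
  case (Suc p)
  have c1: "c + 1 \<notin> \<int>" using Suc.prems Ints_diff[of "c + 1" 1] by auto
  have "bern_head n c + bern_tail_cont (Suc p) n c = c / of_nat (Suc n) * (bern_head (Suc n) (c + 1) + bern_tail_cont p (Suc n) (c + 1))"
    unfolding distrib_left bern_head_step[OF Suc.prems, symmetric] by simp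
  also have "bern_head (Suc n) (c + 1) + bern_tail_cont p (Suc n) (c + 1) =
     pochhammer (c + 1) p * (fact (Suc n) / fact (Suc n + p)) * (bern_head (Suc n + p) (c + 1 + of_nat p) + bern_tail (Suc n + p) (c + 1 + of_nat p))"
    using c1 by (intro Suc.IH) auto
  also have "c / of_nat (Suc n) * \<dots> = pochhammer c (Suc p) * (fact n / fact (n + Suc p)) *
     (bern_head (n + Suc p) (c + of_nat (Suc p)) + bern_tail (n + Suc p) (c + of_nat (Suc p)))"
  proof -
    have e: "c + 1 + of_nat p = c + of_nat (Suc p)" "Suc n + p = n + Suc p" by simp_all
    show ?thesis unfolding pochhammer_rec e by (simp add: fact_Suc del: of_nat_Suc)
  qed
  finally show ?case .
qed simp

text \<open>The terms 1/(s-1) + 1/2 of the Euler-Maclaurin formula are - s times the head for n = 1, so zeta itself is a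
multiple of head plus tail.  Integers s are excluded because the head has its poles there.\<close>
lemma zeta_eq_head_tail:
  assumes s: "s \<notin> \<int>" "Re s > - real p"
  shows "zeta s = - (pochhammer s (Suc p) / fact (Suc p)) *
     (bern_head (Suc p) (s + of_nat (Suc p)) + bern_tail (Suc p) (s + of_nat (Suc p)))"
proof -
  have s1: "s \<noteq> 1" "s \<noteq> 0" "s + 1 \<notin> \<int>" using s Ints_diff[of "s + 1" 1] by auto
  have b1: "bernoulli (Suc 0) = - (1 / 2)" using bernoulli_1 by simp
  have "bern_head 1 (s + 1) = 1 / (2 * s) - 1 / (s - 1)"
    using s1 by (simp add: bern_head_def bernoulli_0 b1 field_simps)
  then have "- s * bern_head 1 (s + 1) = 1 / (s - 1) + 1 / 2"
    using s1 by (simp add: field_simps)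
  then have "zeta s = - s * (bern_head 1 (s + 1) + bern_tail_cont p 1 (s + 1))"
    using zeta_eq_zeta_ext[OF s(2) s1(1)] by (simp add: zeta_ext_def distrib_left)
  also have "\<dots> = - s * (pochhammer (s + 1) p * (fact 1 / fact (1 + p)) * (bern_head (1 + p) (s + 1 + of_nat p) + bern_tail (1 + p) (s + 1 + of_nat p)))"
    by (subst bern_head_add_tail_cont) (use s1 in auto)
  also have "\<dots> = - (pochhammer s (Suc p) / fact (Suc p)) *
     (bern_head (Suc p) (s + of_nat (Suc p)) + bern_tail (Suc p) (s + of_nat (Suc p)))"
    unfolding pochhammer_rec by (simp add: add_ac)
  finally show ?thesis .
qed

lemma continuous_bern_tail: "Re c > 1 \<Longrightarrow> isCont (bern_tail n) c"
  using holomorphic_bern_tail[of n] open_halfspace_Re_gt[of 1]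
  by (auto simp: continuous_on_eq_continuous_at dest: holomorphic_on_imp_continuous_on)

text \<open>Near w = 1 - p the product s(s+1)...(s+p) equals (s - w) R(s).  The head has a single pole there, from the term
k = 1, with coefficient proportional to B_p = 0.  So \<zeta>(s) = (s - w) Q(s) with Q continuous at w, and \<zeta>'(w) = Q(w).\<close>
lemma J_0_via_deriv_zeta_even:
  assumes p: "odd p" "p > 1"
  shows "of_real (J 0 (Suc p)) = - (of_nat p * of_nat (Suc p)) * deriv zeta (- of_nat (p - 1)) +
    of_real (bernoulli (Suc p) - real (Suc p) * (\<Sum>k=1..p. real (p choose k) * bernoulli (p - k) / real k))"
proof -
  define w :: complex where "w = - of_nat (p - 1)"
  have wp: "w + of_nat (Suc p) = 2" "w + of_nat p = 1" using p by (auto simp: w_def of_nat_diff)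
  define R where "R s = pochhammer s (p - 1) * (s + of_nat p)" for s :: complex
  define H where "H s = (\<Sum>k\<in>{..Suc p}-{1}. of_real (real (Suc p choose k) * bernoulli (Suc p - k)) / (of_nat (Suc k) - (s + of_nat (Suc p)))) +
      bern_tail (Suc p) (s + of_nat (Suc p))" for s
  define Q where "Q s = - (R s / fact (Suc p)) * H s" for s
  have zeta_eq: "zeta s = (s - w) * Q s" if s: "s \<in> ball w (1/2) - {w}" for s
  proof -
    have nint: "s \<notin> \<int>"
    proof
      assume "s \<in> \<int>"
      then have "s - w \<in> \<int>" by (auto simp: w_def)
      then obtain i where i: "s - w = of_int i" by (elim Ints_cases)
      have "norm (s - w) < 1/2" using s by (simp add: dist_norm norm_minus_commute)
      then have "\<bar>real_of_int i\<bar> < 1/2" unfolding i by simp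
      then have "i = 0" by linarith
      with i s show False by auto
    qed
    have "\<bar>Re (s - w)\<bar> < 1/2" using s abs_Re_le_cmod[of "s - w"] by (simp add: dist_norm norm_minus_commute)
    moreover have "Re w = 1 - real p" using p by (simp add: w_def of_nat_diff)
    ultimately have "\<bar>Re s - (1 - real p)\<bar> < 1/2" by simp
    then have re: "Re s > - real p" by linarith
    have "bernoulli p = 0" using p by (intro bernoulli_odd) auto
    then have "bern_head (Suc p) (s + of_nat (Suc p)) =
       (\<Sum>k\<in>{..Suc p}-{1}. of_real (real (Suc p choose k) * bernoulli (Suc p - k)) / (of_nat (Suc k) - (s + of_nat (Suc p))))"
      unfolding bern_head_def by (subst sum.remove[of _ 1]) auto
    moreover have "pochhammer s (Suc p) = (s - w) * R s"
    proof -
      have "pochhammer s (Suc (Suc (p - 1))) = pochhammer s (p - 1) * (s + of_nat (p - 1)) * (s + of_nat p)"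
        using p by (simp only: pochhammer_Suc) (simp add: of_nat_diff)
      then show ?thesis using p by (simp add: R_def w_def)
    qed
    ultimately show ?thesis
      unfolding zeta_eq_head_tail[OF nint re] Q_def H_def by simp
  qed
  have denom: "of_nat (Suc k) - (w + of_nat (Suc p)) = of_int (int k - 1)" for k
    unfolding wp by simp
  have cont_tail: "isCont (\<lambda>s. bern_tail (Suc p) (s + of_nat (Suc p))) w"
  proof (intro isCont_o2[OF _ continuous_bern_tail] continuous_intros)
    show "1 < Re (w + of_nat (Suc p))" unfolding wp by simp
  qed
  have cont_sum: "isCont (\<lambda>s. \<Sum>k\<in>{..Suc p}-{1}. of_real (real (Suc p choose k) * bernoulli (Suc p - k)) / (of_nat (Suc k) - (s + of_nat (Suc p)))) w"
  proof (intro continuous_intros)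
    fix k assume "k \<in> {..Suc p} - {1}"
    then have "int k - 1 \<noteq> 0" by auto
    then show "of_nat (Suc k) - (w + of_nat (Suc p)) \<noteq> (0 :: complex)"
      unfolding denom by (simp only: of_int_eq_0_iff) simp
  qed
  have "isCont H w" unfolding H_def by (rule isCont_add[OF cont_sum cont_tail])
  moreover have "isCont R w" unfolding R_def pochhammer_prod by (intro continuous_intros)
  ultimately have contQ: "isCont Q w" unfolding Q_def by (intro continuous_intros) (auto simp del: fact_Suc)
  have ev: "\<forall>\<^sub>F s in at w. s \<in> ball w (1/2) - {w}"
    by (intro eventually_at_in_open) auto
  have w1: "w \<noteq> 1"
  proof
    assume "w = 1"
    then have "Re w = 1" by simp
    then show False by (simp add: w_def)
  qed
  then have "zeta field_differentiable at w"
    using zeta_spec(1) by (intro holomorphic_on_imp_differentiable_at[of _ "- {1}"]) auto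
  then have "isCont zeta w" by (rule field_differentiable_imp_continuous_at)
  moreover have "(zeta \<longlongrightarrow> (w - w) * Q w) (at w)"
  proof (rule Lim_transform_eventually)
    show "((\<lambda>s. (s - w) * Q s) \<longlongrightarrow> (w - w) * Q w) (at w)"
      using contQ unfolding isCont_def by (intro tendsto_intros)
    show "\<forall>\<^sub>F s in at w. (s - w) * Q s = zeta s"
      using ev by eventually_elim (use zeta_eq in auto)
  qed
  ultimately have zw: "zeta w = 0"
    unfolding isCont_def using LIM_unique by fastforce
  have "(zeta has_field_derivative Q w) (at w)"
    unfolding has_field_derivative_iff
  proof (rule Lim_transform_eventually)
    show "(Q \<longlongrightarrow> Q w) (at w)" using contQ by (simp add: isCont_def)
    show "\<forall>\<^sub>F s in at w. Q s = (zeta s - zeta w) / (s - w)"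
      using ev by eventually_elim (use zeta_eq zw in auto)
  qed
  then have dz: "deriv zeta w = Q w" by (rule DERIV_imp_deriv)
  have Rw: "R w = fact (p - 1)"
    unfolding R_def wp unfolding w_def pochhammer_same using p by simp
  have "H w = of_real ((\<Sum>k=2..Suc p. real (Suc p choose k) * bernoulli (Suc p - k) / real (k - 1)) - bernoulli (Suc p)) + of_real (J 0 (Suc p))"
  proof -
    have "{..Suc p} - {1} = insert 0 {2..Suc p}" by auto
    then have "(\<Sum>k\<in>{..Suc p}-{1}. of_real (real (Suc p choose k) * bernoulli (Suc p - k)) / of_int (int k - 1) :: complex)
      = - of_real (bernoulli (Suc p)) + (\<Sum>k=2..Suc p. of_real (real (Suc p choose k) * bernoulli (Suc p - k)) / of_int (int k - 1))"
      by simp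
    also have "(\<Sum>k=2..Suc p. of_real (real (Suc p choose k) * bernoulli (Suc p - k)) / of_int (int k - 1) :: complex) =
       of_real (\<Sum>k=2..Suc p. real (Suc p choose k) * bernoulli (Suc p - k) / real (k - 1))"
      unfolding of_real_sum by (rule sum.cong) (auto simp: of_nat_diff)
    finally show ?thesis unfolding H_def denom wp
      using J_eq_bern_tail[of 0 "Suc p"] by simp
  qed
  also have "(\<Sum>k=2..Suc p. real (Suc p choose k) * bernoulli (Suc p - k) / real (k - 1)) =
     real (Suc p) * (\<Sum>k=1..p. real (p choose k) * bernoulli (p - k) / real k)"
    using sum_binomial_bernoulli_over_pred[of p] bernoulli_odd[of p] p by simp
  finally have Hw: "of_real (J 0 (Suc p)) = H w + of_real (bernoulli (Suc p) - real (Suc p) * (\<Sum>k=1..p. real (p choose k) * bernoulli (p - k) / real k))"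
    by simp
  have "fact (Suc p) = of_nat p * of_nat (Suc p) * (fact (p - 1) :: complex)"
    using p by (simp add: fact_reduce[of p])
  then have "H w = - (of_nat p * of_nat (Suc p)) * deriv zeta w"
    unfolding dz Q_def Rw using p by (simp del: of_nat_Suc)
  then show ?thesis using Hw by (simp add: w_def)
qed

text \<open>Here B_1 \<noteq> 0 and the head does have a pole; a single integration by parts is free of poles near 0 and
suffices.\<close>
lemma J_0_2: "of_real (J 0 2) = of_real (bernoulli 2) - 2 - 2 * deriv zeta 0"
proof -
  define h where "h s = - of_real (bernoulli 2) / 2 + (s + 1) / 2 * bern_tail 2 (s + 2)" for s
  have "bern_tail 2 field_differentiable at 2"
    using holomorphic_bern_tail[of 2] open_halfspace_Re_gt[of 1] by (intro holomorphic_on_imp_differentiable_at) auto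
  then obtain D where "(bern_tail 2 has_field_derivative D) (at (0 + 2))" by (auto simp: field_differentiable_def)
  then have "((\<lambda>s. bern_tail 2 (s + 2)) has_field_derivative D) (at 0)"
    by (simp only: DERIV_shift)
  then have "((\<lambda>s. 1 / (s - 1) + 1 / 2 - s * h s) has_field_derivative (- 1 - h 0)) (at 0)"
    unfolding h_def by (auto intro!: derivative_eq_intros)
  then have "(zeta has_field_derivative (- 1 - h 0)) (at 0)"
  proof (rule has_field_derivative_transform_within_open)
    show "open ({s. Re s > -1} - {1 :: complex})" by (intro open_Diff open_halfspace_Re_gt) auto
    fix s :: complex assume s: "s \<in> {s. Re s > -1} - {1}"
    then have "zeta s = zeta_ext 1 s" by (intro zeta_eq_zeta_ext) auto
    then show "1 / (s - 1) + 1 / 2 - s * h s = zeta s" by (simp add: zeta_ext_def h_def add.assoc flip: Suc_1)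
  qed auto
  then have "deriv zeta 0 = -1 - h 0" by (rule DERIV_imp_deriv)
  moreover have "bern_tail 2 2 = of_real (J 0 2)" using J_eq_bern_tail[of 0 2] by simp
  ultimately show ?thesis by (simp add: h_def)
qed

section \<open>Zeta and its derivative at integers greater than one\<close>

lemma summable_ln_powr: "summable (\<lambda>k. ln (real (Suc k)) * real (Suc k) powr (- (3/2)))"
proof (rule summable_comparison_test')
  show "summable (\<lambda>k. 4 * real (Suc k) powr (- (5/4)))" by (rule summable_powr_Suc) simp
  fix k :: nat
  have "ln (real (Suc k)) \<le> real (Suc k) powr (1/4) / (1/4)" by (rule ln_powr_bound) auto
  then have "ln (real (Suc k)) * real (Suc k) powr (- (3/2)) \<le> real (Suc k) powr (1/4) / (1/4) * real (Suc k) powr (- (3/2))"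
    by (intro mult_right_mono) auto
  also have "\<dots> = 4 * real (Suc k) powr (- (5/4))" by (simp add: powr_add[symmetric] del: of_nat_Suc)
  finally show "norm (ln (real (Suc k)) * real (Suc k) powr (- (3/2))) \<le> 4 * real (Suc k) powr (- (5/4))"
    by (simp add: abs_mult del: of_nat_Suc)
qed

lemma summable_ln_over_power:
  assumes "p \<ge> 2" shows "summable (\<lambda>k. ln (real (Suc k)) / real (Suc k) ^ p)"
proof (rule summable_comparison_test'[OF summable_ln_powr])
  fix k :: nat
  have "1 / real (Suc k) ^ p = real (Suc k) powr (- real p)"
    by (simp add: powr_minus powr_realpow divide_inverse del: of_nat_Suc)
  also have "\<dots> \<le> real (Suc k) powr (- (3/2))" using assms by (intro powr_mono) auto
  finally have "ln (real (Suc k)) * (1 / real (Suc k) ^ p) \<le> ln (real (Suc k)) * real (Suc k) powr (- (3/2))"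
    by (intro mult_left_mono) auto
  then show "norm (ln (real (Suc k)) / real (Suc k) ^ p) \<le> ln (real (Suc k)) * real (Suc k) powr (- (3/2))"
    by (simp del: of_nat_Suc)
qed

lemma summable_inverse_power_Suc: "p \<ge> 2 \<Longrightarrow> summable (\<lambda>k. 1 / real (Suc k) ^ p)"
  using inverse_power_summable[of p, where 'a = real] summable_Suc_iff[of "\<lambda>k. inverse (real k ^ p)"]
  by (simp add: divide_inverse)

lemma of_nat_powr_minus_of_nat:
  "of_nat (Suc k) powr (- of_nat p) = (of_real (1 / real (Suc k) ^ p) :: complex)"
proof -
  have "of_nat (Suc k) powr (- of_nat p) = inverse (of_nat (Suc k) ^ p :: complex)"
    using of_nat_neq_0[of k, where 'a = complex] by (simp only: powr_minus powr_nat if_False)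
  then show ?thesis by (simp add: divide_inverse del: of_nat_Suc)
qed

lemma zeta_of_nat:
  assumes "p \<ge> 2" shows "zeta (of_nat p) = of_real (\<Sum>k. 1 / real (Suc k) ^ p)"
proof (rule sums_unique2)
  show "(\<lambda>k. of_nat (Suc k) powr (- of_nat p)) sums zeta (of_nat p)"
    using assms by (intro zeta_spec) auto
  show "(\<lambda>k. of_nat (Suc k) powr (- of_nat p)) sums (of_real (\<Sum>k. 1 / real (Suc k) ^ p) :: complex)"
    unfolding of_nat_powr_minus_of_nat by (intro sums_of_real summable_sums summable_inverse_power_Suc assms)
qed

lemma deriv_zeta_of_nat:
  assumes "p \<ge> 2" shows "deriv zeta (of_nat p) = - of_real (\<Sum>k. ln (real (Suc k)) / real (Suc k) ^ p)"
proof -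
  define S where "S = {s :: complex. Re s \<ge> 3/2}"
  define f where "f k s = (of_nat (Suc k) :: complex) powr (- s)" for k s
  define f' where "f' k s = - (of_real (ln (real (Suc k))) * f k s)" for k s
  have nz: "of_nat (Suc k) \<noteq> (0 :: complex)" for k by (simp del: of_nat_Suc)
  have deriv: "(f k has_field_derivative f' k s) (at s within T)" for k s T
  proof -
    have "Ln (of_nat (Suc k)) = of_real (ln (real (Suc k)))"
      using Ln_of_real[of "real (Suc k)"] by (simp del: of_nat_Suc)
    then show ?thesis
      using DERIV_chain2[OF has_field_derivative_powr_right[OF nz[of k]] DERIV_minus[OF DERIV_ident]]
      unfolding f_def f'_def by (simp add: mult_ac del: of_nat_Suc)
  qed
  have int: "of_nat p \<in> interior S"
  proof -
    have "{s. Re s > 3/2} \<subseteq> interior S" unfolding S_def by (intro interior_maximal open_halfspace_Re_gt) auto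
    then show ?thesis using assms by force
  qed
  then have inS: "of_nat p \<in> S" using interior_subset by blast
  have "((\<lambda>s. \<Sum>k. f k s) has_field_derivative (\<Sum>k. f' k (of_nat p))) (at (of_nat p))"
  proof (rule has_field_derivative_series'(2)[OF _ deriv _ inS _ int])
    show "convex S" unfolding S_def by (rule convex_halfspace_Re_ge)
    \<comment> \<open>The exponent -3/2 is a bound on the whole half plane S and leaves room for the logarithm.\<close>
    have "uniform_limit S (\<lambda>n s. \<Sum>k<n. f' k s) (\<lambda>s. \<Sum>k. f' k s) sequentially"
    proof (rule Weierstrass_m_test[OF _ summable_ln_powr])
      fix k :: nat and s assume s: "s \<in> S"
      have "norm (f k s) = real (Suc k) powr (- Re s)" unfolding f_def
        by (subst norm_powr_real_powr) (auto simp del: of_nat_Suc)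
      also have "\<dots> \<le> real (Suc k) powr (- (3/2))" using s by (intro powr_mono) (auto simp: S_def)
      finally have "\<bar>ln (real (Suc k))\<bar> * norm (f k s) \<le> ln (real (Suc k)) * real (Suc k) powr (- (3/2))"
        by (simp add: mult_left_mono del: of_nat_Suc)
      then show "norm (f' k s) \<le> ln (real (Suc k)) * real (Suc k) powr (- (3/2))"
        by (simp add: f'_def norm_mult del: of_nat_Suc)
    qed
    then show "uniformly_convergent_on S (\<lambda>n s. \<Sum>k<n. f' k s)" by (auto simp: uniformly_convergent_on_def)
    show "summable (\<lambda>k. f k (of_nat p))"
      using zeta_spec(2)[of "of_nat p"] assms by (auto simp: f_def dest: sums_summable)
  qed
  then have "(zeta has_field_derivative (\<Sum>k. f' k (of_nat p))) (at (of_nat p))"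
  proof (rule has_field_derivative_transform_within_open)
    show "open {s :: complex. Re s > 1}" by (rule open_halfspace_Re_gt)
    show "(\<Sum>k. f k s) = zeta s" if "s \<in> {s. Re s > 1}" for s
      using zeta_spec(2)[of s] that by (auto simp: f_def dest: sums_unique)
  qed (use assms in auto)
  then have "deriv zeta (of_nat p) = (\<Sum>k. f' k (of_nat p))" by (rule DERIV_imp_deriv)
  also have "(\<lambda>k. f' k (of_nat p)) sums (of_real (- (\<Sum>k. ln (real (Suc k)) / real (Suc k) ^ p)))"
  proof -
    have "f' k (of_nat p) = of_real (- (ln (real (Suc k)) / real (Suc k) ^ p))" for k
      unfolding f'_def f_def of_nat_powr_minus_of_nat by (simp del: of_nat_Suc)
    then show ?thesis
      by (simp only:) (intro sums_of_real sums_minus summable_sums summable_ln_over_power assms)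
  qed
  then have "(\<Sum>k. f' k (of_nat p)) = of_real (- (\<Sum>k. ln (real (Suc k)) / real (Suc k) ^ p))"
    by (rule sums_unique[symmetric])
  finally show ?thesis by simp
qed


section \<open>The cosine integral at infinity\<close>

lemma abs_diff_le_of_abs_deriv_le:
  fixes f \<phi> :: "real \<Rightarrow> real"
  assumes "a \<le> b" "continuous_on {a..b} f" "continuous_on {a..b} \<phi>"
    and f: "\<And>x. a < x \<Longrightarrow> x < b \<Longrightarrow> (f has_real_derivative f' x) (at x)"
    and \<phi>: "\<And>x. a < x \<Longrightarrow> x < b \<Longrightarrow> (\<phi> has_real_derivative \<phi>' x) (at x)"
    and le: "\<And>x. a < x \<Longrightarrow> x < b \<Longrightarrow> \<bar>f' x\<bar> \<le> \<phi>' x"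
  shows "\<bar>f b - f a\<bar> \<le> \<phi> b - \<phi> a"
proof -
  have "\<phi> a - f a \<le> \<phi> b - f b"
  proof (rule DERIV_nonneg_imp_increasing_open[of a b "\<lambda>x. \<phi> x - f x"])
    fix x assume x: "a < x" "x < b"
    show "\<exists>y. ((\<lambda>x. \<phi> x - f x) has_real_derivative y) (at x) \<and> y \<ge> 0"
      using DERIV_diff[OF \<phi>[OF x] f[OF x]] le[OF x] by (intro exI conjI) auto
  qed (use assms in \<open>auto intro: continuous_intros\<close>)
  moreover have "\<phi> a + f a \<le> \<phi> b + f b"
  proof (rule DERIV_nonneg_imp_increasing_open[of a b "\<lambda>x. \<phi> x + f x"])
    fix x assume x: "a < x" "x < b"
    show "\<exists>y. ((\<lambda>x. \<phi> x + f x) has_real_derivative y) (at x) \<and> y \<ge> 0"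
      using DERIV_add[OF \<phi>[OF x] f[OF x]] le[OF x] by (intro exI conjI) auto
  qed (use assms in \<open>auto intro: continuous_intros\<close>)
  ultimately show ?thesis by linarith
qed

text \<open>A weak form of the Jordan inequality; any positive slope serves for the estimate on the arc.\<close>
lemma sin_ge_half:
  assumes "0 \<le> t" "t \<le> pi / 2" shows "t / 2 \<le> sin t"
proof (cases "t \<le> pi / 3")
  case True
  have "sin 0 - 0 / 2 \<le> sin t - t / 2"
  proof (rule DERIV_nonneg_imp_increasing_open[of 0 t "\<lambda>t. sin t - t / 2"])
    fix x assume x: "0 < x" "x < t"
    have "cos (pi / 3) \<le> cos x" using x True by (intro cos_monotone_0_pi_le) auto
    then have "cos x \<ge> 1 / 2" by (simp add: cos_60)
    then show "\<exists>y. ((\<lambda>t. sin t - t / 2) has_real_derivative y) (at x) \<and> y \<ge> 0"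
      by (intro exI[of _ "cos x - 1/2"]) (auto intro!: derivative_eq_intros)
  qed (use assms in \<open>auto intro!: continuous_intros\<close>)
  then show ?thesis by simp
next
  case False
  have "sin (pi / 3) \<le> sin t" using False assms by (intro sin_monotone_2pi_le) auto
  then have "sqrt 3 / 2 \<le> sin t" by (simp add: sin_60)
  moreover have "sqrt 3 \<ge> 17/10" by (rule real_le_rsqrt) (simp add: power2_eq_square)
  moreover have "pi \<le> 34/10" using pi_approx(2) by simp
  ultimately show ?thesis using assms by linarith
qed

text \<open>The upper bound combines (1 + t/N)^N \<le> exp t with the Bernoulli inequality for
(1 - t/N)^N (1 + t/N)^N = (1 - t^2/N^2)^N.\<close>
lemma exp_minus_power_bounds:
  fixes t :: real
  assumes N: "N > 0" and t: "0 \<le> t" "t \<le> real N"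
  shows "0 \<le> exp (- t) - (1 - t / real N) ^ N" "exp (- t) - (1 - t / real N) ^ N \<le> t\<^sup>2 * exp (- t) / real N"
proof -
  have e: "exp (- t / real N) ^ N = exp (- t)" "exp (t / real N) ^ N = exp t"
    using N by (simp_all flip: exp_of_nat_mult)
  have "1 - t / real N \<le> exp (- t / real N)" using exp_ge_add_one_self[of "- t / real N"] by simp
  then have "(1 - t / real N) ^ N \<le> exp (- t / real N) ^ N" using t N by (intro power_mono) auto
  then show "0 \<le> exp (- t) - (1 - t / real N) ^ N" unfolding e by simp
  have "1 - t\<^sup>2 / real N = 1 + real N * (- (t / real N)\<^sup>2)" using N by (simp add: power2_eq_square)
  also have "\<dots> \<le> (1 + (- (t / real N)\<^sup>2)) ^ N"
    using t N by (intro Bernoulli_inequality) (simp add: power_le_one)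
  also have "1 + (- (t / real N)\<^sup>2) = (1 - t / real N) * (1 + t / real N)" by (simp add: power2_eq_square algebra_simps)
  also have "\<dots> ^ N = (1 - t / real N) ^ N * (1 + t / real N) ^ N" by (rule power_mult_distrib)
  also have "\<dots> \<le> (1 - t / real N) ^ N * exp (t / real N) ^ N"
    using t N exp_ge_add_one_self[of "t / real N"] by (intro mult_left_mono power_mono) auto
  also have "\<dots> = (1 - t / real N) ^ N * exp t" unfolding e ..
  finally have "(1 - t\<^sup>2 / real N) * exp (- t) \<le> (1 - t / real N) ^ N * exp t * exp (- t)"
    by (intro mult_right_mono) auto
  then show "exp (- t) - (1 - t / real N) ^ N \<le> t\<^sup>2 * exp (- t) / real N"
    by (simp add: mult.assoc flip: exp_add) (simp add: algebra_simps)
qed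

text \<open>The N-th harmonic number is the integral of (1 - (1 - t/N)^N) / t over [0, N], which is compared with the
integral E(N) of (1 - exp(-t)) / t; the difference of the integrands is at most t exp(-t) / N.\<close>
lemma harm_close_to_Ein:
  fixes E :: "real \<Rightarrow> real"
  assumes E0: "E 0 = 0" and contE: "continuous_on {0..} E"
    and E': "\<And>x. x > 0 \<Longrightarrow> (E has_real_derivative (1 - exp (- x)) / x) (at x)"
    and N: "N > 0"
  shows "\<bar>harm N - E (real N)\<bar> \<le> 1 / real N"
proof -
  define h where "h t = (\<Sum>k=1..N. (1 - (1 - t / real N) ^ k) / real k)" for t
  have h': "(h has_real_derivative (1 - (1 - t / real N) ^ N) / t) (at t)" if t: "t > 0" for t
  proof -
    have "(h has_real_derivative (\<Sum>k=1..N. (1 - t / real N) ^ (k - 1) / real N)) (at t)"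
      unfolding h_def
    proof (rule DERIV_sum)
      fix k assume k: "k \<in> {1..N}"
      show "((\<lambda>t. (1 - (1 - t / real N) ^ k) / real k) has_real_derivative (1 - t / real N) ^ (k - 1) / real N) (at t)"
        using k N by (auto intro!: derivative_eq_intros)
    qed
    also have "(\<Sum>k=1..N. (1 - t / real N) ^ (k - 1) / real N) = (\<Sum>k<N. (1 - t / real N) ^ k) / real N"
      unfolding sum_divide_distrib by (rule sum.reindex_bij_witness[of _ Suc "\<lambda>k. k - 1"]) auto
    also have "\<dots> = (1 - (1 - t / real N) ^ N) / t"
      using t N geometric_sum[of "1 - t / real N" N] by (simp add: field_simps)
    finally show ?thesis .
  qed
  \<comment> \<open>An antiderivative of the bound t exp(-t) / N.\<close>
  define \<phi> where "\<phi> t = - ((t + 1) * exp (- t)) / real N" for t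
  have "\<bar>(h (real N) - E (real N)) - (h 0 - E 0)\<bar> \<le> \<phi> (real N) - \<phi> 0"
  proof (rule abs_diff_le_of_abs_deriv_le)
    show "continuous_on {0..real N} (\<lambda>t. h t - E t)"
      unfolding h_def using N by (intro continuous_intros continuous_on_subset[OF contE]) auto
    show "continuous_on {0..real N} \<phi>" unfolding \<phi>_def using N by (intro continuous_intros) auto
    fix t assume t: "0 < t" "t < real N"
    show "((\<lambda>t. h t - E t) has_real_derivative (1 - (1 - t / real N) ^ N) / t - (1 - exp (- t)) / t) (at t)"
      using t by (intro DERIV_diff h' E')
    show "(\<phi> has_real_derivative t * exp (- t) / real N) (at t)"
      unfolding \<phi>_def using N by (auto intro!: derivative_eq_intros simp: field_simps)
    have "(1 - (1 - t / real N) ^ N) / t - (1 - exp (- t)) / t = (exp (- t) - (1 - t / real N) ^ N) / t"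
      using t by (simp add: field_simps)
    moreover have "(exp (- t) - (1 - t / real N) ^ N) / t \<le> t * exp (- t) / real N"
    proof -
      have "(exp (- t) - (1 - t / real N) ^ N) / t \<le> (t\<^sup>2 * exp (- t) / real N) / t"
        using t N exp_minus_power_bounds(2)[of N t] by (intro divide_right_mono) auto
      then show ?thesis using t by (simp add: power2_eq_square)
    qed
    moreover have "0 \<le> (exp (- t) - (1 - t / real N) ^ N) / t"
      using t N exp_minus_power_bounds(1)[of N t] by simp
    ultimately show "\<bar>(1 - (1 - t / real N) ^ N) / t - (1 - exp (- t)) / t\<bar> \<le> t * exp (- t) / real N" by simp
  qed simp
  moreover have "h 0 = 0" by (simp add: h_def)
  moreover have "h (real N) = harm N" using N by (auto simp: h_def harm_def divide_inverse intro!: sum.cong)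
  moreover have "\<phi> (real N) \<le> 0" by (simp add: \<phi>_def)
  moreover have "\<phi> 0 = - 1 / real N" by (simp add: \<phi>_def)
  ultimately show ?thesis using E0 by simp
qed

text \<open>The comparison with harmonic numbers yields the limit along the integers, and E(x) - ln x is decreasing.\<close>
lemma Ein_asymptotics:
  fixes E :: "real \<Rightarrow> real"
  assumes E0: "E 0 = 0" and contE: "continuous_on {0..} E"
    and E': "\<And>x. x > 0 \<Longrightarrow> (E has_real_derivative (1 - exp (- x)) / x) (at x)"
  shows "((\<lambda>x. E x - ln x) \<longlongrightarrow> euler_mascheroni) at_top"
proof -
  define D where "D x = E x - ln x" for x
  have anti: "D y \<le> D x" if "0 < x" "x \<le> y" for x y
  proof (rule DERIV_nonpos_imp_nonincreasing[OF that(2)])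
    fix t assume t: "x \<le> t" "t \<le> y"
    have "(D has_real_derivative (1 - exp (- t)) / t - 1 / t) (at t)"
      unfolding D_def using t that by (intro DERIV_diff E') (auto intro!: derivative_eq_intros)
    moreover have "(1 - exp (- t)) / t - 1 / t \<le> 0" using t that by (simp add: field_simps)
    ultimately show "\<exists>y. (D has_real_derivative y) (at t) \<and> y \<le> 0" by blast
  qed
  have lim: "(\<lambda>N. D (real N)) \<longlonglongrightarrow> euler_mascheroni"
  proof -
    have "(\<lambda>N. harm N - E (real N)) \<longlonglongrightarrow> 0"
    proof (rule Lim_null_comparison)
      show "\<forall>\<^sub>F N in sequentially. norm (harm N - E (real N)) \<le> 1 / real N"
        using eventually_gt_at_top[of 0] by eventually_elim (use harm_close_to_Ein[OF E0 contE E'] in auto)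
    qed real_asymp
    from tendsto_diff[OF euler_mascheroni_LIMSEQ this] show ?thesis by (simp add: D_def)
  qed
  have fl: "filterlim (\<lambda>x::real. nat \<lfloor>x\<rfloor>) sequentially at_top" by real_asymp
  have "(D \<longlongrightarrow> euler_mascheroni) at_top"
  proof (rule tendsto_sandwich)
    show "\<forall>\<^sub>F x in at_top. D (real (Suc (nat \<lfloor>x\<rfloor>))) \<le> D x"
      using eventually_ge_at_top[of 1] by eventually_elim (rule anti, linarith+)
    show "\<forall>\<^sub>F x in at_top. D x \<le> D (real (nat \<lfloor>x\<rfloor>))"
      using eventually_ge_at_top[of 1] by eventually_elim (rule anti, linarith+)
    show "((\<lambda>x::real. D (real (Suc (nat \<lfloor>x\<rfloor>)))) \<longlongrightarrow> euler_mascheroni) at_top"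
      using filterlim_compose[OF LIMSEQ_Suc[OF lim] fl] .
    show "((\<lambda>x::real. D (real (nat \<lfloor>x\<rfloor>))) \<longlongrightarrow> euler_mascheroni) at_top"
      using filterlim_compose[OF lim fl] .
  qed
  then show ?thesis by (simp add: D_def[abs_def])
qed

lemma DERIV_Re_comp:
  assumes "(\<gamma> has_vector_derivative \<gamma>') (at x)" "(G has_field_derivative D) (at (\<gamma> x))"
  shows "((\<lambda>x. Re (G (\<gamma> x))) has_real_derivative Re (\<gamma>' * D)) (at x)"
  using bounded_linear.has_vector_derivative[OF bounded_linear_Re field_vector_diff_chain_at[OF assms]]
  by (simp add: has_real_derivative_iff_has_vector_derivative o_def)

text \<open>C(x) is the integral of (1 - cos t) / t over [0, x].  It is the real part at x of a primitive G of the entire function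
(1 - exp(iz)) / z, and the real part of G at ix is the integral of (1 - exp(-t)) / t over [0, x].  The two differ by the
contribution of a quarter circle, which is O(1/x).  So C(x) = ln x + \<gamma> + o(1) follows from the real exponential
integral.\<close>
lemma Cin_exists:
  obtains C :: "real \<Rightarrow> real" where "C 0 = 0" "continuous_on UNIV C"
    "\<And>x. x > 0 \<Longrightarrow> (C has_real_derivative (1 - cos x) / x) (at x)"
    "((\<lambda>x. C x - ln x) \<longlongrightarrow> euler_mascheroni) at_top"
proof -
  define f where "f z = (1 - exp (\<i> * z)) / z" for z :: complex
  define g where "g z = (if z = 0 then - \<i> else f z)" for z
  have "f \<midarrow>0\<rightarrow> - \<i>"
  proof -
    have "((\<lambda>z. exp (\<i> * z)) has_field_derivative \<i>) (at 0)"
      by (auto intro!: derivative_eq_intros)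
    then have "((\<lambda>z. (exp (\<i> * z) - 1) / z) \<longlongrightarrow> \<i>) (at 0)"
      by (simp add: has_field_derivative_iff)
    from tendsto_minus[OF this] show ?thesis by (simp add: f_def[abs_def] minus_divide_left)
  qed
  then have "g holomorphic_on UNIV"
    unfolding g_def by (intro removable_singularity) (auto simp: f_def[abs_def] intro!: holomorphic_intros)
  then obtain G0 where G0: "\<And>z. (G0 has_field_derivative g z) (at z)"
    using holomorphic_convex_primitive'[of UNIV g] by auto
  define G where "G z = G0 z - G0 0" for z
  have G: "(G has_field_derivative g z) (at z)" for z
    unfolding G_def using DERIV_diff[OF G0 DERIV_const] by simp
  have contG: "continuous_on S G" for S
    using G by (meson DERIV_isCont continuous_at_imp_continuous_on)
  define C where "C x = Re (G (of_real x))" for x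
  define E where "E x = Re (G (\<i> * of_real x))" for x
  have C': "(C has_real_derivative (1 - cos x) / x) (at x)" if x: "x > 0" for x
  proof -
    have "(of_real has_vector_derivative 1) (at x)"
      using has_vector_derivative_of_real[OF DERIV_ident] by simp
    from DERIV_Re_comp[OF this G] have "(C has_real_derivative Re (g (of_real x))) (at x)"
      unfolding C_def by simp
    moreover have "Re (g (of_real x)) = (1 - cos x) / x"
      using x by (simp add: g_def f_def Re_divide_of_real Re_exp)
    ultimately show ?thesis by simp
  qed
  have E': "(E has_real_derivative (1 - exp (- x)) / x) (at x)" if x: "x > 0" for x
  proof -
    have "((\<lambda>x. \<i> * of_real x) has_vector_derivative \<i>) (at x)"
      using has_vector_derivative_mult_right[OF has_vector_derivative_of_real[OF DERIV_ident], of \<i>] by simp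
    from DERIV_Re_comp[OF this G] have "(E has_real_derivative Re (\<i> * g (\<i> * of_real x))) (at x)"
      unfolding E_def .
    moreover have "\<i> * g (\<i> * of_real x) = of_real ((1 - exp (- x)) / x)"
      using x by (simp add: g_def f_def exp_of_real flip: of_real_minus mult.assoc)
    ultimately show ?thesis by simp
  qed
  \<comment> \<open>Along the arc x exp(it) the real part of G has derivative at most exp(-x sin t) \<le> exp(-xt/2) in absolute value.\<close>
  have arc: "\<bar>E x - C x\<bar> \<le> 2 / x" if x: "x > 0" for x
  proof -
    define A where "A t = Re (G (of_real x * exp (\<i> * of_real t)))" for t
    have "\<bar>A (pi / 2) - A 0\<bar> \<le> - (2 / x) * exp (- x * (pi / 2) / 2) - (- (2 / x) * exp (- x * 0 / 2))"
    proof (rule abs_diff_le_of_abs_deriv_le[where \<phi>' = "\<lambda>t. exp (- x * t / 2)" and f = A and \<phi> = "\<lambda>t. - (2 / x) * exp (- x * t / 2)"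
           and f' = "\<lambda>t. Im (exp (\<i> * (of_real x * exp (\<i> * of_real t))))"])
      show "continuous_on {0..pi / 2} A" unfolding A_def
        by (intro continuous_intros continuous_on_compose2[OF contG[of UNIV]]) auto
      show "continuous_on {0..pi / 2} (\<lambda>t. - (2 / x) * exp (- x * t / 2))" by (intro continuous_intros) auto
      fix t assume t: "0 < t" "t < pi / 2"
      let ?z = "of_real x * exp (\<i> * of_real t)"
      have "((\<lambda>z. of_real x * exp (\<i> * z)) has_field_derivative \<i> * ?z) (at (of_real t))"
        by (auto intro!: derivative_eq_intros)
      from has_vector_derivative_real_field[OF this, of UNIV]
      have "((\<lambda>t. of_real x * exp (\<i> * of_real t)) has_vector_derivative \<i> * ?z) (at t)" .
      from DERIV_Re_comp[OF this G] have "(A has_real_derivative Re (\<i> * ?z * g ?z)) (at t)"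
        unfolding A_def .
      moreover have "\<i> * ?z * g ?z = \<i> * (1 - exp (\<i> * ?z))"
        using x by (simp add: g_def f_def)
      ultimately show "(A has_real_derivative Im (exp (\<i> * ?z))) (at t)" by simp
      show "((\<lambda>t. - (2 / x) * exp (- x * t / 2)) has_real_derivative exp (- x * t / 2)) (at t)"
        using x by (auto intro!: derivative_eq_intros)
      have "\<bar>Im (exp (\<i> * ?z))\<bar> \<le> norm (exp (\<i> * ?z))" by (rule abs_Im_le_cmod)
      also have "\<dots> = exp (- x * sin t)" by (simp add: Im_exp)
      also have "\<dots> \<le> exp (- x * t / 2)" using sin_ge_half[of t] t x by (simp add: field_simps)
      finally show "\<bar>Im (exp (\<i> * ?z))\<bar> \<le> exp (- x * t / 2)" .
    qed simp
    also have "- (2 / x) * exp (- x * (pi / 2) / 2) - (- (2 / x) * exp (- x * 0 / 2)) \<le> 2 / x" using x by simp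
    also have "A (pi / 2) = E x" 
      using cis_pi_half by (simp add: A_def E_def cis_conv_exp mult.commute)
    also have "A 0 = C x" by (simp add: A_def C_def)
    finally show ?thesis .
  qed
  have contE: "continuous_on {0..} E" unfolding E_def
    by (intro continuous_intros continuous_on_compose2[OF contG[of UNIV]]) auto
  have "((\<lambda>x. E x - ln x) \<longlongrightarrow> euler_mascheroni) at_top"
    by (rule Ein_asymptotics[OF _ contE E']) (auto simp: E_def G_def)
  moreover have "((\<lambda>x. E x - C x) \<longlongrightarrow> 0) at_top"
  proof (rule Lim_null_comparison)
    show "\<forall>\<^sub>F x in at_top. norm (E x - C x) \<le> 2 / x"
      using eventually_gt_at_top[of 0] by eventually_elim (use arc in auto)
  qed real_asymp
  ultimately have "((\<lambda>x. (E x - ln x) - (E x - C x)) \<longlongrightarrow> euler_mascheroni - 0) at_top"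
    by (rule tendsto_diff)
  then have lim: "((\<lambda>x. C x - ln x) \<longlongrightarrow> euler_mascheroni) at_top" by simp
  have "continuous_on UNIV C" unfolding C_def
    by (intro continuous_intros continuous_on_compose2[OF contG[of UNIV]]) auto
  moreover have "C 0 = 0" by (simp add: C_def G_def)
  ultimately show ?thesis using that C' lim by blast
qed

section \<open>The integrals J with k = 0 and odd index\<close>

text \<open>\<Psi>(x) is the integral of (t - sin t) / t^2 over [0, x]; integration by parts gives \<Psi>(x) = C(x) - 1 + sin x / x
with C from \<open>Cin_exists\<close>.  Subtracting t from sin t makes the integral converge at 0.\<close>
lemma Psi_exists:
  obtains \<Psi> :: "real \<Rightarrow> real" where "\<Psi> 0 = 0" "continuous_on {0..} \<Psi>"
    "\<And>x. x > 0 \<Longrightarrow> (\<Psi> has_real_derivative (x - sin x) / x\<^sup>2) (at x)"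
    "((\<lambda>x. \<Psi> x - ln x) \<longlongrightarrow> euler_mascheroni - 1) at_top"
    "\<And>x y. 0 \<le> x \<Longrightarrow> x \<le> y \<Longrightarrow> \<Psi> x \<le> \<Psi> y"
proof -
  obtain C :: "real \<Rightarrow> real" where C: "C 0 = 0" "continuous_on UNIV C"
    "\<And>x. x > 0 \<Longrightarrow> (C has_real_derivative (1 - cos x) / x) (at x)"
    "((\<lambda>x. C x - ln x) \<longlongrightarrow> euler_mascheroni) at_top"
    by (rule Cin_exists) blast
  define S where "S x = (if x = 0 then 1 else sin x / x)" for x :: real
  define \<Psi> where "\<Psi> x = C x - 1 + S x" for x
  have deriv: "(\<Psi> has_real_derivative (x - sin x) / x\<^sup>2) (at x)" if x: "x > 0" for x
  proof -
    have "((\<lambda>x. C x - 1 + sin x / x) has_real_derivative ((1 - cos x) / x - 0 + (cos x * x - sin x * 1) / (x * x))) (at x)"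
      using x by (intro DERIV_add DERIV_diff C DERIV_const DERIV_divide DERIV_sin DERIV_ident) auto
    also have "(1 - cos x) / x - 0 + (cos x * x - sin x * 1) / (x * x) = (x - sin x) / x\<^sup>2"
      using x by (simp add: field_simps power2_eq_square)
    finally show ?thesis
    proof (rule has_field_derivative_transform_within_open)
      show "C x - 1 + sin x / x = \<Psi> x" if "x \<in> {0<..}" for x using that by (simp add: \<Psi>_def S_def)
    qed (use x in auto)
  qed
  have "continuous_on {0..} S"
    unfolding continuous_on_eq_continuous_within
  proof
    fix x :: real assume x: "x \<in> {0..}"
    have "isCont S x"
    proof (cases "x = 0")
      case True
      have "((\<lambda>x. sin x / x) \<longlongrightarrow> 1) (at (0::real))"
        using DERIV_sin[of "0::real"] by (simp add: has_field_derivative_iff)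
      then have "(S \<longlongrightarrow> 1) (at 0)"
        by (rule Lim_transform_eventually) (auto simp: S_def eventually_at intro!: exI[of _ 1])
      then show ?thesis unfolding isCont_def True by (simp add: S_def)
    next
      case False
      have "isCont (\<lambda>x. sin x / x) x" using False by (intro continuous_intros) auto
      moreover have "\<forall>\<^sub>F y in nhds x. sin y / y = S y"
        using t1_space_nhds[OF False] by eventually_elim (simp add: S_def)
      ultimately show ?thesis using isCont_cong by fastforce
    qed
    then show "continuous (at x within {0..}) S" by (rule continuous_at_imp_continuous_within)
  qed
  then have cont: "continuous_on {0..} \<Psi>"
    unfolding \<Psi>_def by (intro continuous_intros continuous_on_subset[OF C(2)]) auto
  have "((\<lambda>x. (C x - ln x) - 1 + sin x / x) \<longlongrightarrow> euler_mascheroni - 1 + 0) at_top"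
  proof (intro tendsto_intros C)
    show "((\<lambda>x::real. sin x / x) \<longlongrightarrow> 0) at_top"
    proof (rule Lim_null_comparison)
      show "\<forall>\<^sub>F x in at_top. norm (sin x / x) \<le> 1 / (x::real)"
        using eventually_gt_at_top[of 0] by eventually_elim (auto simp: abs_divide intro!: divide_right_mono)
    qed real_asymp
  qed
  moreover have "\<forall>\<^sub>F x in at_top. (C x - ln x) - 1 + sin x / x = \<Psi> x - ln x"
    using eventually_gt_at_top[of 0] by eventually_elim (simp add: \<Psi>_def S_def)
  ultimately have "((\<lambda>x. \<Psi> x - ln x) \<longlongrightarrow> euler_mascheroni - 1 + 0) at_top"
    by (rule Lim_transform_eventually)
  then have lim: "((\<lambda>x. \<Psi> x - ln x) \<longlongrightarrow> euler_mascheroni - 1) at_top" by simp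
  have mono: "\<Psi> x \<le> \<Psi> y" if "0 \<le> x" "x \<le> y" for x y
  proof (rule DERIV_nonneg_imp_increasing_open[OF that(2)])
    show "continuous_on {x..y} \<Psi>" using that by (intro continuous_on_subset[OF cont]) auto
    fix t assume t: "x < t" "t < y"
    then have "(\<Psi> has_real_derivative (t - sin t) / t\<^sup>2) (at t)" using that by (intro deriv) auto
    moreover have "(t - sin t) / t\<^sup>2 \<ge> 0" using sin_x_le_x[of t] that t by simp
    ultimately show "\<exists>D. (\<Psi> has_real_derivative D) (at t) \<and> D \<ge> 0" by blast
  qed
  show ?thesis using that[OF _ cont deriv lim mono] by (simp add: \<Psi>_def S_def C)
qed

text \<open>Write B_q({u}) / q! = \<Sum> c_k sin(a_k u) with a_k = 2\<pi>(k+1), so that \<beta> = B_(q-1) / (q-1)! = \<Sum> c_k a_k.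
The function \<Theta>(u) = \<Sum> c_k a_k \<Psi>(a_k u) has derivative (\<beta>u - B_q({u}) / q!) / u^2, so \<beta> ln u - \<Theta>(u) is an
antiderivative of B_q({u}) / (q! u^2).  Its limit at infinity is known from the asymptotics of \<Psi>, and its value
at 1 from the fact that \<Theta> is a polynomial on [0, 1].\<close>
lemma J_0_odd_index:
  assumes q: "odd q" "q \<ge> 3"
  shows "J 0 q = real q * (- bernoulli (q - 1) * (euler_mascheroni + ln (2 * pi))
      + (- bernoulli (q - 1) * (\<Sum>k. ln (real (Suc k)) / real (Suc k) ^ (q - 1)) / (\<Sum>k. 1 / real (Suc k) ^ (q - 1)))
      - (\<Sum>k=1..q - 1. real (q - 1 choose k) * bernoulli (q - 1 - k) / real k))"
proof -
  define p where "p = q - 1"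
  have qp: "q = Suc p" and p: "p \<ge> 2" using q by (auto simp: p_def)
  obtain r where r: "q = 2 * r + 1" using q by (elim oddE)
  then have pr: "p = 2 * r" by (simp add: p_def)
  obtain \<Psi> :: "real \<Rightarrow> real" where \<Psi>: "\<Psi> 0 = 0" "continuous_on {0..} \<Psi>"
    "\<And>x. x > 0 \<Longrightarrow> (\<Psi> has_real_derivative (x - sin x) / x\<^sup>2) (at x)"
    "((\<lambda>x. \<Psi> x - ln x) \<longlongrightarrow> euler_mascheroni - 1) at_top"
    "\<And>x y. 0 \<le> x \<Longrightarrow> x \<le> y \<Longrightarrow> \<Psi> x \<le> \<Psi> y"
    by (rule Psi_exists) blast
  define a where "a k = 2 * pi * real (Suc k)" for k
  define c where "c k = - 2 * (-1) ^ r / a k ^ q" for k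
  define \<beta> where "\<beta> = bernoulli p / fact p"
  have a0: "a k > 0" for k by (simp add: a_def)
  have a_ge_1: "a k \<ge> 1" for k
  proof -
    have "1 * 1 \<le> (2 * pi) * real (Suc k)" using pi_gt3 by (intro mult_mono) auto
    then show ?thesis by (simp add: a_def)
  qed
  have ln_a: "ln (a k) = ln (2 * pi) + ln (real (Suc k))" for k
    unfolding a_def by (rule ln_mult_pos) auto

  have sums_sin: "(\<lambda>k. c k * sin (a k * u)) sums bern_fourier q u" for u
  proof -
    have "bern_fourier_term q k u = c k * sin (a k * u)" for k
    proof -
      have "cos (a k * u - real q * pi / 2) = cos ((a k * u - real r * pi) - pi / 2)"
        by (rule arg_cong[of _ _ cos]) (simp add: r field_simps)
      also have "\<dots> = sin (a k * u - real r * pi)" by (simp add: cos_diff)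
      also have "\<dots> = (-1) ^ r * sin (a k * u)" by (simp add: sin_diff mult.commute)
      finally show ?thesis unfolding bern_fourier_term_def a_def[symmetric] c_def by simp
    qed
    then show ?thesis using summable_sums[OF summable_bern_fourier_term[of q u]] q by (simp add: bern_fourier_def)
  qed
  have ca: "c k * a k = bern_fourier_term p k 0" for k
  proof -
    have "cos (0 - real p * pi / 2) = (-1) ^ r" by (simp add: pr mult.commute)
    then have "bern_fourier_term p k 0 = - 2 * (-1) ^ r / a k ^ p" unfolding bern_fourier_term_def a_def[symmetric] by simp
    then show ?thesis using a0[of k] by (simp add: c_def qp)
  qed
  have abs_ca: "\<bar>c k * a k\<bar> \<le> 2 * inverse (real (Suc k) ^ 2)" for k
    using norm_bern_fourier_term_le[OF p, of k 0] unfolding ca by simp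
  have sums_ca: "(\<lambda>k. c k * a k) sums \<beta>"
    using summable_sums[OF summable_bern_fourier_term[OF p, of 0]] bernpoly_eq_bern_fourier[OF p, of 0]
    unfolding ca by (simp add: \<beta>_def bern_fourier_def bernoulli_def)

  \<comment> \<open>As \<Psi> is increasing and grows like a logarithm, M X majorises the series for \<Theta> on [0, X].\<close>
  define M where "M X k = 2 * inverse (real (Suc k) ^ 2) * \<Psi> (a k * X)" for X k
  have \<Psi>_nonneg: "\<Psi> x \<ge> 0" if "x \<ge> 0" for x using \<Psi>(5)[of 0 x] \<Psi>(1) that by simp
  have summable_M: "summable (M X)" if X: "X > 0" for X
  proof (rule summable_comparison_test_ev)
    show "summable (\<lambda>k. 2 * (ln (real (Suc k)) / real (Suc k) ^ 2) + 2 * (ln (2 * pi * X) + euler_mascheroni) * (1 / real (Suc k) ^ 2))"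
      by (intro summable_add summable_mult summable_ln_over_power summable_inverse_power_Suc) auto
    have "filterlim (\<lambda>k. a k * X) at_top sequentially"
      unfolding a_def using X pi_gt_zero by real_asymp
    moreover have "\<forall>\<^sub>F x in at_top. \<Psi> x - ln x < euler_mascheroni"
      by (rule order_tendstoD(2)[OF \<Psi>(4)]) simp
    ultimately have "\<forall>\<^sub>F k in sequentially. \<Psi> (a k * X) - ln (a k * X) < euler_mascheroni"
      by (rule eventually_compose_filterlim[rotated])
    then show "\<forall>\<^sub>F k in sequentially. norm (M X k) \<le> 2 * (ln (real (Suc k)) / real (Suc k) ^ 2) + 2 * (ln (2 * pi * X) + euler_mascheroni) * (1 / real (Suc k) ^ 2)"
    proof eventually_elim
      case (elim k)
      have "ln (a k * X) = ln (real (Suc k)) + ln (2 * pi * X)"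
        using X by (simp add: a_def ln_mult del: of_nat_Suc)
      with elim have "\<Psi> (a k * X) \<le> ln (real (Suc k)) + (ln (2 * pi * X) + euler_mascheroni)" by simp
      then have "inverse (real (Suc k) ^ 2) * \<Psi> (a k * X) \<le> inverse (real (Suc k) ^ 2) * (ln (real (Suc k)) + (ln (2 * pi * X) + euler_mascheroni))"
        by (intro mult_left_mono) auto
      moreover have "norm (M X k) = 2 * (inverse (real (Suc k) ^ 2) * \<Psi> (a k * X))"
        using \<Psi>_nonneg[of "a k * X"] a0[of k] X by (simp add: M_def abs_mult del: of_nat_Suc)
      ultimately show ?case by (simp add: divide_inverse distrib_left mult_ac del: of_nat_Suc)
    qed
  qed
  define \<theta> where "\<theta> k u = c k * a k * \<Psi> (a k * u)" for k u
  define \<Theta> where "\<Theta> u = (\<Sum>k. \<theta> k u)" for u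
  have \<theta>_le: "norm (\<theta> k u) \<le> M X k" if "u \<in> {0..X}" for k u X
  proof -
    have "\<bar>c k * a k\<bar> * \<bar>\<Psi> (a k * u)\<bar> \<le> 2 * inverse (real (Suc k) ^ 2) * \<Psi> (a k * X)"
      using that a0[of k] \<Psi>(5)[of "a k * u" "a k * X"] \<Psi>_nonneg[of "a k * u"]
      by (intro mult_mono abs_ca) auto
    then show ?thesis by (simp add: \<theta>_def M_def abs_mult)
  qed
  have summable_\<theta>: "summable (\<lambda>k. \<theta> k u)" if "u > 0" for u
    by (rule summable_comparison_test'[OF summable_M[OF that] \<theta>_le]) (use that in auto)
  have cont_\<Theta>: "continuous_on {0..X} \<Theta>" if "X > 0" for X
  proof (rule uniform_limit_theorem)
    show "uniform_limit {0..X} (\<lambda>n u. \<Sum>k<n. \<theta> k u) \<Theta> sequentially"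
      unfolding \<Theta>_def[abs_def] by (rule Weierstrass_m_test[OF \<theta>_le summable_M[OF that]])
    have "continuous_on {0..X} (\<theta> k)" for k
      unfolding \<theta>_def[abs_def] using a0[of k]
      by (intro continuous_intros continuous_on_compose2[OF \<Psi>(2)]) auto
    then show "\<forall>\<^sub>F n in sequentially. continuous_on {0..X} (\<lambda>u. \<Sum>k<n. \<theta> k u)"
      by (intro always_eventually allI continuous_on_sum)
  qed simp
  have \<Theta>': "(\<Theta> has_real_derivative (\<beta> * u - bern_fourier q u) / u\<^sup>2) (at u)" if u: "u > 0" for u
  proof -
    define \<theta>' where "\<theta>' k v = (c k * a k * v - c k * sin (a k * v)) / v\<^sup>2" for k v
    define S where "S = {u / 2..2 * u}"
    have uS: "u \<in> S" "u \<in> interior S" using u by (auto simp: S_def interior_atLeastAtMost_real)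
    have "((\<lambda>u. \<Sum>k. \<theta> k u) has_real_derivative (\<Sum>k. \<theta>' k u)) (at u)"
    proof (rule has_field_derivative_series'(2)[where f = \<theta> and f' = \<theta>' and S = S and ?x0.0 = u])
      show "convex S" by (simp add: S_def)
      fix k v assume v: "v \<in> S"
      then have v0: "v > 0" using u by (auto simp: S_def)
      have "((\<lambda>v. \<Psi> (a k * v)) has_real_derivative (a k * v - sin (a k * v)) / (a k * v)\<^sup>2 * a k) (at v within S)"
        using a0[of k] v0
        by (intro DERIV_chain2[OF has_field_derivative_at_within[OF \<Psi>(3)]] has_field_derivative_at_within[OF DERIV_cmult_Id]) auto
      note DERIV_cmult[OF this, of "c k * a k"]
      then have "(\<theta> k has_real_derivative c k * a k * ((a k * v - sin (a k * v)) / (a k * v)\<^sup>2 * a k)) (at v within S)"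
        unfolding \<theta>_def .
      moreover have "c k * a k * ((a k * v - sin (a k * v)) / (a k * v)\<^sup>2 * a k) = \<theta>' k v"
        unfolding \<theta>'_def using a0[of k] v0 by (simp add: divide_simps) (simp add: algebra_simps power2_eq_square)
      ultimately show "(\<theta> k has_real_derivative \<theta>' k v) (at v within S)" by simp
    next
      have "uniform_limit S (\<lambda>n v. \<Sum>k<n. \<theta>' k v) (\<lambda>v. \<Sum>k. \<theta>' k v) sequentially"
      proof (rule Weierstrass_m_test)
        show "summable (\<lambda>k. (2 * u + 1) / (u / 2)\<^sup>2 * (2 * inverse (real (Suc k) ^ 2)))"
          by (intro summable_mult summable_inverse_squares)
        fix k v assume v: "v \<in> S"
        have c_le: "\<bar>c k\<bar> \<le> 2 * inverse (real (Suc k) ^ 2)"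
        proof -
          have "\<bar>c k\<bar> * 1 \<le> \<bar>c k\<bar> * \<bar>a k\<bar>" using a_ge_1[of k] by (intro mult_left_mono) auto
          then show ?thesis using abs_ca[of k] unfolding abs_mult by linarith
        qed
        have "\<bar>c k * a k * v - c k * sin (a k * v)\<bar> \<le> \<bar>c k * a k\<bar> * \<bar>v\<bar> + \<bar>c k\<bar> * \<bar>sin (a k * v)\<bar>"
          unfolding abs_mult[symmetric] by (rule abs_triangle_ineq4)
        also have "\<dots> \<le> 2 * inverse (real (Suc k) ^ 2) * (2 * u) + 2 * inverse (real (Suc k) ^ 2) * 1"
          using v u by (intro add_mono mult_mono abs_ca c_le) (auto simp: S_def)
        finally have "\<bar>c k * a k * v - c k * sin (a k * v)\<bar> / v\<^sup>2 \<le>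
            (2 * inverse (real (Suc k) ^ 2) * (2 * u) + 2 * inverse (real (Suc k) ^ 2) * 1) / (u / 2)\<^sup>2"
          using v u by (intro frac_le power_mono) (auto simp: S_def)
        also have "\<dots> = (2 * u + 1) / (u / 2)\<^sup>2 * (2 * inverse (real (Suc k) ^ 2))"
          by (simp add: distrib_left distrib_right add_divide_distrib mult_ac)
        finally show "norm (\<theta>' k v) \<le> (2 * u + 1) / (u / 2)\<^sup>2 * (2 * inverse (real (Suc k) ^ 2))"
          by (simp add: \<theta>'_def abs_divide)
      qed
      then show "uniformly_convergent_on S (\<lambda>n v. \<Sum>k<n. \<theta>' k v)" by (auto simp: uniformly_convergent_on_def)
    qed (use uS summable_\<theta>[OF u] in auto)
    moreover have "(\<lambda>k. \<theta>' k u) sums ((\<beta> * u - bern_fourier q u) / u\<^sup>2)"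
      unfolding \<theta>'_def by (intro sums_divide sums_diff sums_mult2 sums_ca sums_sin)
    ultimately show ?thesis unfolding \<Theta>_def by (simp add: sums_iff)
  qed

  define G where "G u = \<beta> * ln u - \<Theta> u" for u
  have G': "(G has_real_derivative bern_fourier q u / u\<^sup>2) (at u)" if u: "u > 0" for u
  proof -
    have "(G has_real_derivative \<beta> * (1 / u) - (\<beta> * u - bern_fourier q u) / u\<^sup>2) (at u)"
      unfolding G_def using u by (intro DERIV_diff \<Theta>' DERIV_cmult) (auto intro!: derivative_eq_intros)
    moreover have "\<beta> * (1 / u) - (\<beta> * u - bern_fourier q u) / u\<^sup>2 = bern_fourier q u / u\<^sup>2"
      using u by (simp add: field_simps power2_eq_square)
    ultimately show ?thesis by simp
  qed
  have piece: "integral {0..1} (\<lambda>t. bernpoly q t / (real (Suc m) + t) ^ (0 + 2)) = fact q * (G (real (Suc (Suc m))) - G (real (Suc m)))" for m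
  proof -
    have "((\<lambda>t. bern_fourier q (real (Suc m) + t) / (real (Suc m) + t)\<^sup>2) has_integral (G (real (Suc m) + 1) - G (real (Suc m) + 0))) {0..1}"
    proof (rule fundamental_theorem_of_calculus)
      fix t :: real assume t: "t \<in> {0..1}"
      have "((\<lambda>t. G (real (Suc m) + t)) has_real_derivative bern_fourier q (real (Suc m) + t) / (real (Suc m) + t)\<^sup>2 * (0 + 1)) (at t within {0..1})"
        using t by (intro DERIV_chain2[OF G'] DERIV_add DERIV_const DERIV_ident) auto
      then show "((\<lambda>t. G (real (Suc m) + t)) has_vector_derivative bern_fourier q (real (Suc m) + t) / (real (Suc m) + t)\<^sup>2) (at t within {0..1})"
        by (simp add: has_real_derivative_iff_has_vector_derivative)
    qed simp
    from has_integral_mult_right[OF this, of "fact q"]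
    have "((\<lambda>t. bernpoly q t / (real (Suc m) + t) ^ (0 + 2)) has_integral (fact q * (G (real (Suc m) + 1) - G (real (Suc m) + 0)))) {0..1}"
    proof (rule has_integral_eq[rotated])
      fix t :: real assume t: "t \<in> {0..1}"
      have "bern_fourier q (real (Suc m) + t) = bernpoly q t / fact q"
        using bernpoly_eq_bern_fourier[of q t] bern_fourier_plus_nat[of q t "Suc m"] q t by (simp add: add.commute)
      then show "fact q * (bern_fourier q (real (Suc m) + t) / (real (Suc m) + t)\<^sup>2) = bernpoly q t / (real (Suc m) + t) ^ (0 + 2)"
        by (simp add: power2_eq_square)
    qed
    then show ?thesis by (simp add: integral_unique add_ac)
  qed
  define \<Lambda> where "\<Lambda> = (\<Sum>k. c k * a k * ln (a k))"
  have summable_\<Lambda>: "summable (\<lambda>k. c k * a k * ln (a k))"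
  proof (rule summable_comparison_test')
    show "summable (\<lambda>k. 2 * ln (2 * pi) * (1 / real (Suc k) ^ 2) + 2 * (ln (real (Suc k)) / real (Suc k) ^ 2))"
      by (intro summable_add summable_mult summable_ln_over_power summable_inverse_power_Suc) auto
    fix k
    have "\<bar>c k * a k\<bar> * \<bar>ln (a k)\<bar> \<le> 2 * inverse (real (Suc k) ^ 2) * ln (a k)"
      using a_ge_1[of k] by (intro mult_mono abs_ca) auto
    also have "\<dots> = 2 * ln (2 * pi) * (1 / real (Suc k) ^ 2) + 2 * (ln (real (Suc k)) / real (Suc k) ^ 2)"
      unfolding ln_a by (simp add: divide_inverse distrib_left mult_ac del: of_nat_Suc)
    finally show "norm (c k * a k * ln (a k)) \<le> 2 * ln (2 * pi) * (1 / real (Suc k) ^ 2) + 2 * (ln (real (Suc k)) / real (Suc k) ^ 2)"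
      unfolding real_norm_def abs_mult[of "c k * a k"] .
  qed
  have lim_G: "(\<lambda>N. G (real (Suc N))) \<longlonglongrightarrow> (1 - euler_mascheroni) * \<beta> - \<Lambda>"
  proof -
    \<comment> \<open>All arguments of \<epsilon> in the series R N are at least N + 1, so \<epsilon> is small there uniformly in k.\<close>
    define \<epsilon> where "\<epsilon> x = \<Psi> x - ln x - (euler_mascheroni - 1)" for x
    define R where "R N = (\<Sum>k. c k * a k * \<epsilon> (a k * real (Suc N)))" for N
    have eq: "G (real (Suc N)) = (1 - euler_mascheroni) * \<beta> - \<Lambda> - R N" for N
    proof -
      have "(\<lambda>k. \<theta> k (real (Suc N)) - c k * a k * ln (a k) - c k * a k * (ln (real (Suc N)) + (euler_mascheroni - 1))) sums
          (\<Theta> (real (Suc N)) - \<Lambda> - \<beta> * (ln (real (Suc N)) + (euler_mascheroni - 1)))"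
        unfolding \<Theta>_def \<Lambda>_def
        by (intro sums_diff sums_mult2 sums_ca summable_sums summable_\<theta> summable_\<Lambda>) auto
      moreover have "\<theta> k (real (Suc N)) - c k * a k * ln (a k) - c k * a k * (ln (real (Suc N)) + (euler_mascheroni - 1))
          = c k * a k * \<epsilon> (a k * real (Suc N))" for k
      proof -
        have "ln (a k * real (Suc N)) = ln (a k) + ln (real (Suc N))" using a0[of k] by (intro ln_mult_pos) auto
        then show ?thesis by (simp add: \<theta>_def \<epsilon>_def algebra_simps del: of_nat_Suc)
      qed
      ultimately have "R N = \<Theta> (real (Suc N)) - \<Lambda> - \<beta> * (ln (real (Suc N)) + (euler_mascheroni - 1))"
        unfolding R_def by (simp add: sums_iff)
      then show ?thesis by (simp add: G_def algebra_simps)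
    qed
    have "R \<longlonglongrightarrow> 0"
    proof (rule LIMSEQ_I)
      fix e :: real assume e: "e > 0"
      define K where "K = (\<Sum>k. 2 * inverse (real (Suc k) ^ 2))"
      have K: "K \<ge> 0" unfolding K_def by (intro suminf_nonneg summable_inverse_squares) simp
      define d where "d = e / (K + 1)"
      have d: "d > 0" using e K by (simp add: d_def)
      have "(\<epsilon> \<longlongrightarrow> 0) at_top"
        unfolding \<epsilon>_def using tendsto_diff[OF \<Psi>(4) tendsto_const[of "euler_mascheroni - 1"]] by simp
      then have "\<forall>\<^sub>F x in at_top. \<bar>\<epsilon> x\<bar> < d" using d by (auto dest!: tendstoD[of _ 0] simp: dist_real_def)
      then obtain Y where Y: "\<And>x. x \<ge> Y \<Longrightarrow> \<bar>\<epsilon> x\<bar> < d" by (auto simp: eventually_at_top_linorder)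
      have "norm (R N - 0) < e" if N: "N \<ge> nat \<lceil>Y\<rceil>" for N
      proof -
        have "norm (R N) \<le> (\<Sum>k. 2 * inverse (real (Suc k) ^ 2) * d)"
          unfolding R_def
        proof (rule norm_suminf_le)
          show "summable (\<lambda>k. 2 * inverse (real (Suc k) ^ 2) * d)"
            by (intro summable_mult2 summable_inverse_squares)
          fix k
          have "1 * real (Suc N) \<le> a k * real (Suc N)" using a_ge_1[of k] by (intro mult_right_mono) auto
          moreover have "Y \<le> 1 * real (Suc N)" using N real_nat_ceiling_ge[of Y] by simp
          ultimately have "a k * real (Suc N) \<ge> Y" by (rule order.trans[rotated])
          from Y[OF this] have "\<bar>c k * a k\<bar> * \<bar>\<epsilon> (a k * real (Suc N))\<bar> \<le> 2 * inverse (real (Suc k) ^ 2) * d"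
            by (intro mult_mono abs_ca) auto
          then show "norm (c k * a k * \<epsilon> (a k * real (Suc N))) \<le> 2 * inverse (real (Suc k) ^ 2) * d"
            unfolding real_norm_def abs_mult[of "c k * a k"] .
        qed
        also have "\<dots> = K * d" unfolding K_def by (rule suminf_mult2[OF summable_inverse_squares, symmetric])
        also have "\<dots> < e" using e K by (simp add: d_def field_simps)
        finally show ?thesis by simp
      qed
      then show "\<exists>N0. \<forall>N\<ge>N0. norm (R N - 0) < e" by blast
    qed
    then have "(\<lambda>N. (1 - euler_mascheroni) * \<beta> - \<Lambda> - R N) \<longlonglongrightarrow> (1 - euler_mascheroni) * \<beta> - \<Lambda> - 0"
      by (intro tendsto_intros)
    then show ?thesis unfolding eq by simp
  qed
  have "(\<lambda>N. \<Sum>m<N. integral {0..1} (\<lambda>t. bernpoly q t / (real (Suc m) + t) ^ (0 + 2))) \<longlonglongrightarrow>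
      fact q * (((1 - euler_mascheroni) * \<beta> - \<Lambda>) - G 1)"
  proof -
    have "(\<Sum>m<N. integral {0..1} (\<lambda>t. bernpoly q t / (real (Suc m) + t) ^ (0 + 2))) = fact q * (G (real (Suc N)) - G 1)" for N
      unfolding piece sum_distrib_left[symmetric] using sum_lessThan_telescope[of "\<lambda>m. G (real (Suc m))" N] by simp
    then show ?thesis by (simp only:) (intro tendsto_intros lim_G)
  qed
  then have J: "J 0 q = fact q * (((1 - euler_mascheroni) * \<beta> - \<Lambda>) - G 1)"
    using J_sums[of q 0] by (auto simp: sums_def dest: LIMSEQ_unique)
  have q\<beta>: "fact q * \<beta> = real q * bernoulli p" by (simp add: \<beta>_def qp del: of_nat_Suc)
  have G1: "fact q * G 1 = (\<Sum>k=2..q. real (q choose k) * bernoulli (q - k) / real (k - 1))"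
  proof -
    define P where "P u = (\<Sum>k=2..q. real (q choose k) * bernoulli (q - k) / real (k - 1) * u ^ (k - 1))" for u
    have "fact q * \<Theta> 1 + P 1 = fact q * \<Theta> 0 + P 0"
    proof (rule DERIV_isconst_end[where f = "\<lambda>u. fact q * \<Theta> u + P u"])
      show "continuous_on {0..1} (\<lambda>u. fact q * \<Theta> u + P u)"
        unfolding P_def by (intro continuous_intros cont_\<Theta>) auto
      fix u :: real assume u: "0 < u" "u < 1"
      have "(P has_real_derivative (\<Sum>k=2..q. real (q choose k) * bernoulli (q - k) * u ^ (k - 2))) (at u)"
        unfolding P_def
      proof (rule DERIV_sum)
        fix k assume k: "k \<in> {2..q}"
        have "((\<lambda>u. real (q choose k) * bernoulli (q - k) / real (k - 1) * u ^ (k - 1)) has_real_derivative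
           real (q choose k) * bernoulli (q - k) / real (k - 1) * (real (k - 1) * u ^ (k - 1 - Suc 0))) (at u)"
          by (intro DERIV_cmult DERIV_pow)
        moreover have "a / X * (X * v) = a * v" if "X \<noteq> 0" for a X v :: real using that by simp
        moreover have "real (k - 1) \<noteq> 0" "k - 1 - Suc 0 = k - 2" using k by auto
        ultimately show "((\<lambda>u. real (q choose k) * bernoulli (q - k) / real (k - 1) * u ^ (k - 1)) has_real_derivative
           real (q choose k) * bernoulli (q - k) * u ^ (k - 2)) (at u)" by (simp only: not_False_eq_True)
      qed
      moreover have "((\<lambda>u. fact q * \<Theta> u) has_real_derivative fact q * ((\<beta> * u - bern_fourier q u) / u\<^sup>2)) (at u)"
        by (intro DERIV_cmult \<Theta>' u)
      moreover have "fact q * ((\<beta> * u - bern_fourier q u) / u\<^sup>2) = - (\<Sum>k=2..q. real (q choose k) * bernoulli (q - k) * u ^ (k - 2))"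
      proof -
        have "bern_fourier q u = bernpoly q u / fact q" using bernpoly_eq_bern_fourier[of q u] q u by simp
        then have "fact q * bern_fourier q u = (\<Sum>k=0..q. real (q choose k) * bernoulli (q - k) * u ^ k)"
          by (simp add: bernpoly_expand atMost_atLeast0)
        also have "\<dots> = bernoulli q + real q * bernoulli p * u + (\<Sum>k=2..q. real (q choose k) * bernoulli (q - k) * u ^ k)"
          using q by (simp add: sum.atLeast_Suc_atMost p_def numeral_2_eq_2)
        also have "bernoulli q = 0" using q by (intro bernoulli_odd) auto
        also have "(\<Sum>k=2..q. real (q choose k) * bernoulli (q - k) * u ^ k) =
             u\<^sup>2 * (\<Sum>k=2..q. real (q choose k) * bernoulli (q - k) * u ^ (k - 2))"
          unfolding sum_distrib_left
        proof (rule sum.cong)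
          fix k assume "k \<in> {2..q}"
          then have "2 \<le> k" by simp
          then have "2 + (k - 2) = k" by (rule le_add_diff_inverse)
          then have "u ^ k = u\<^sup>2 * u ^ (k - 2)" using power_add[of u 2 "k - 2"] by (simp only:)
          then show "real (q choose k) * bernoulli (q - k) * u ^ k = u\<^sup>2 * (real (q choose k) * bernoulli (q - k) * u ^ (k - 2))"
            by simp
        qed simp
        finally have "fact q * (\<beta> * u - bern_fourier q u) = - (u\<^sup>2 * (\<Sum>k=2..q. real (q choose k) * bernoulli (q - k) * u ^ (k - 2)))"
          unfolding right_diff_distrib mult.assoc[symmetric] q\<beta> by simp
        then show ?thesis using u by (simp add: divide_simps mult.commute)
      qed
      ultimately show "((\<lambda>u. fact q * \<Theta> u + P u) has_real_derivative 0) (at u)"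
        using DERIV_add by fastforce
    qed simp
    moreover have "\<Theta> 0 = 0" by (simp add: \<Theta>_def \<theta>_def \<Psi>(1))
    moreover have "P 0 = 0" unfolding P_def by (rule sum.neutral) auto
    ultimately show ?thesis by (simp add: G_def P_def)
  qed
  define Z where "Z = (\<Sum>k. 1 / real (Suc k) ^ p)"
  define L where "L = (\<Sum>k. ln (real (Suc k)) / real (Suc k) ^ p)"
  define \<kappa> where "\<kappa> = - 2 * (-1) ^ r / (2 * pi) ^ p"
  have ca_eq: "c k * a k = \<kappa> * (1 / real (Suc k) ^ p)" for k
  proof -
    have "c k * a k = - 2 * (-1) ^ r / a k ^ p" using a0[of k] by (simp add: c_def qp)
    then show ?thesis by (simp add: \<kappa>_def a_def power_mult_distrib del: of_nat_Suc)
  qed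
  have "(\<lambda>k. c k * a k) sums (\<kappa> * Z)"
    unfolding ca_eq Z_def by (intro sums_mult summable_sums summable_inverse_power_Suc p)
  then have \<beta>Z: "\<beta> = \<kappa> * Z" using sums_ca by (rule sums_unique2[symmetric])
  have Z: "Z > 0" unfolding Z_def by (intro suminf_pos summable_inverse_power_Suc p) auto
  have "(\<lambda>k. c k * a k * ln (2 * pi) + \<kappa> * (ln (real (Suc k)) / real (Suc k) ^ p)) sums (\<beta> * ln (2 * pi) + \<kappa> * L)"
    unfolding L_def by (intro sums_add sums_mult sums_mult2 sums_ca summable_sums summable_ln_over_power p)
  moreover have "c k * a k * ln (2 * pi) + \<kappa> * (ln (real (Suc k)) / real (Suc k) ^ p) = c k * a k * ln (a k)" for k
    unfolding ln_a ca_eq by (simp add: distrib_left del: of_nat_Suc)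
  ultimately have "\<Lambda> = \<beta> * ln (2 * pi) + \<kappa> * L" by (simp add: \<Lambda>_def sums_iff)
  also have "\<kappa> = \<beta> / Z" using \<beta>Z Z by simp
  finally have \<Lambda>: "\<Lambda> = \<beta> * (ln (2 * pi) + L / Z)" by (simp add: distrib_left)
  have "J 0 q = (fact q * \<beta>) * ((1 - euler_mascheroni) - (ln (2 * pi) + L / Z)) - fact q * G 1"
    unfolding J \<Lambda> by (simp add: algebra_simps)
  also have "\<dots> = real q * (bernoulli p * ((1 - euler_mascheroni) - (ln (2 * pi) + L / Z)) -
      ((\<Sum>k=1..p. real (p choose k) * bernoulli (p - k) / real k) + bernoulli p))"
  proof -
    have "1 \<le> p" using p by simp
    note pred = sum_binomial_bernoulli_over_pred[OF this, folded qp]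
    show ?thesis unfolding q\<beta> G1 pred by (simp only: right_diff_distrib mult.assoc)
  qed
  also have "\<dots> = real q * (- bernoulli p * (euler_mascheroni + ln (2 * pi)) + (- bernoulli p * L / Z) -
      (\<Sum>k=1..p. real (p choose k) * bernoulli (p - k) / real k))"
    by (simp add: algebra_simps)
  finally show ?thesis unfolding p_def L_def Z_def .
qed

section \<open>Closed forms\<close>

text \<open>The value m = 2 is separate from the other even ones because B_1 \<noteq> 0.\<close>
theorem J_0_eq_b_seq:
  assumes m: "m \<ge> 2"
  shows "complex_of_real (J 0 m) = of_real (bernoulli m) + of_nat m * of_nat (m - 1) * b_seq (m - 2)"
proof -
  define T where "T = (\<Sum>k=1..m - 1. real (m - 1 choose k) * bernoulli (m - 1 - k) / real k)"
  have m1: "of_nat (m - 1) \<noteq> (0 :: complex)" using m by (simp only: of_nat_eq_0_iff)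
  have Suc: "m - 2 + 1 = m - 1" using m by simp
  have b: "of_nat (m - 1) * b_seq (m - 2) = of_nat (m - 1) * a_seq (m - 2) - of_real T"
    unfolding b_seq_def Suc using m1 by (simp add: right_diff_distrib T_def)
  consider "m = 2" | "even m" "m > 2" | "odd m"
    using m by (metis le_neq_implies_less)
  then show ?thesis
  proof cases
    case 1
    have "T = 1" using 1 by (simp add: T_def bernoulli_0)
    then have "b_seq 0 = - deriv zeta 0 - 1" using b unfolding 1 by (simp add: a_seq_def)
    then show ?thesis using J_0_2 unfolding 1 by simp
  next
    case 2
    have "complex_of_real (J 0 (Suc (m - 1))) = - (of_nat (m - 1) * of_nat (Suc (m - 1))) * deriv zeta (- of_nat (m - 1 - 1)) +
      of_real (bernoulli (Suc (m - 1)) - real (Suc (m - 1)) * T)"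
      unfolding T_def using 2 by (intro J_0_via_deriv_zeta_even) auto
    moreover have "Suc (m - 1) = m" "m - 1 - 1 = m - 2" using m by auto
    moreover have "a_seq (m - 2) = - deriv zeta (- of_nat (m - 2))" using 2 by (simp add: a_seq_def)
    ultimately show ?thesis using b by (simp add: mult.assoc) (simp add: algebra_simps)
  next
    case 3
    define Z where "Z = (\<Sum>k. 1 / real (Suc k) ^ (m - 1))"
    define L where "L = (\<Sum>k. ln (real (Suc k)) / real (Suc k) ^ (m - 1))"
    have m3: "m \<ge> 3" using 3 m by presburger
    have "odd (m - 2)" using 3 m3 by simp
    then have "of_nat (m - 1) * a_seq (m - 2) = of_real (bernoulli (m - 1)) *
        (deriv zeta (of_nat (m - 1)) / zeta (of_nat (m - 1)) - of_real (ln (2 * pi)) - euler_mascheroni)"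
      unfolding a_seq_def Suc using m1 by simp
    also have "zeta (of_nat (m - 1)) = of_real Z" unfolding Z_def using m3 by (intro zeta_of_nat) auto
    also have "deriv zeta (of_nat (m - 1)) = - of_real L" unfolding L_def using m3 by (intro deriv_zeta_of_nat) auto
    also have "of_real (bernoulli (m - 1)) * (- of_real L / of_real Z - of_real (ln (2 * pi)) - euler_mascheroni) =
        complex_of_real (bernoulli (m - 1) * (- L / Z - ln (2 * pi) - euler_mascheroni))"
      by simp
    finally have a: "of_nat (m - 1) * a_seq (m - 2) = complex_of_real (bernoulli (m - 1) * (- L / Z - ln (2 * pi) - euler_mascheroni))" .
    have "J 0 m = real m * (- bernoulli (m - 1) * (euler_mascheroni + ln (2 * pi)) + (- bernoulli (m - 1) * L / Z) - T)"
      using J_0_odd_index[OF 3 m3] by (simp only: T_def L_def Z_def)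
    also have "\<dots> = real m * (bernoulli (m - 1) * (- L / Z - ln (2 * pi) - euler_mascheroni) - T)"
      by (simp add: algebra_simps)
    finally have "complex_of_real (J 0 m) = of_nat m * (of_nat (m - 1) * b_seq (m - 2))"
      unfolding b a by simp
    moreover have "bernoulli m = 0" using 3 m3 by (intro bernoulli_odd) auto
    ultimately show ?thesis by simp
  qed
qed

lemma J_1_eq_zeta:
  "of_nat ((d + 2) * (d + 1)) * complex_of_real (J (Suc d) 1) = 1 + of_nat (d + 1) * (1 / 2 - zeta (of_nat (d + 2)))"
proof -
  define s :: complex where "s = of_nat (d + 2)"
  have re: "Re s > 1" by (simp add: s_def)
  have s1: "s - 1 = of_nat (d + 1)" by (simp add: s_def)
  have nz: "of_nat (d + 1) \<noteq> (0 :: complex)" by (simp only: of_nat_eq_0_iff)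
  have "zeta s = 1 / (s - 1) + 1 / 2 - s * bern_tail 1 (s + 1)"
    using sums_unique2[OF zeta_spec(2)[OF re] Dirichlet_series_eq[OF re]] .
  moreover have "bern_tail 1 (s + 1) = of_real (J (Suc d) 1)"
    unfolding J_eq_bern_tail by (simp add: s_def add_ac)
  ultimately have z: "zeta s = 1 / of_nat (d + 1) + 1 / 2 - s * of_real (J (Suc d) 1)"
    unfolding s1 by simp
  have "1 + of_nat (d + 1) * (1 / 2 - zeta s) = of_nat (d + 1) * (s * of_real (J (Suc d) 1))"
    unfolding z using nz by (simp add: right_diff_distrib distrib_left del: of_nat_add)
  then show ?thesis unfolding s_def by (simp only: of_nat_mult mult_ac)
qed

text \<open>The recurrence raises n and k together.  After multiplication by the binomial coefficient it adds B_(n+1) with the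
weight (n+d+1 choose n+1), which is the next term of the sum if n + 1 is even and zero otherwise.\<close>
lemma J_closed_form_ge:
  fixes d :: nat
  assumes "n \<ge> 1"
  shows "of_nat (n + d + 1) * of_nat (n + d choose n) * complex_of_real (J (n + d) n) =
      (\<Sum>j=0..n div 2. of_nat (d + 2 * j choose (2 * j)) * of_real (bernoulli (2 * j))) +
      of_nat (d + 1) * (1 / 2 - zeta (of_nat (d + 2)))"
  using assms
proof (induction n rule: nat_induct_at_least)
  case base
  have "of_nat (1 + d + 1) * of_nat (1 + d choose 1) = (of_nat ((d + 2) * (d + 1)) :: complex)"
    by (simp only: choose_one of_nat_mult[symmetric]) (simp add: algebra_simps)
  then show ?case using J_1_eq_zeta[of d] by (simp add: bernoulli_0)
next
  case (Suc n)
  let ?C = "Suc n + d choose Suc n"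
  let ?S = "\<lambda>n. \<Sum>j=0..n div 2. of_nat (d + 2 * j choose (2 * j)) * complex_of_real (bernoulli (2 * j))"
  have "real (n + d + 2) * J (Suc (n + d)) (Suc n) = bernoulli (Suc n) + real (Suc n) * J (n + d) n"
    using Suc by (intro J_recurrence) auto
  then have "complex_of_real (real (n + d + 2) * J (Suc (n + d)) (Suc n)) = of_real (bernoulli (Suc n) + real (Suc n) * J (n + d) n)"
    by (simp only:)
  then have rec: "of_nat (n + d + 2) * complex_of_real (J (Suc (n + d)) (Suc n)) = of_real (bernoulli (Suc n)) + of_nat (Suc n) * of_real (J (n + d) n)"
    by (simp only: of_real_mult of_real_add of_real_of_nat_eq)
  have "Suc n * ?C = (n + d + 1) * (n + d choose n)"
    using Suc_times_binomial[of n "n + d"] by simp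
  then have C: "of_nat (Suc n) * of_nat ?C = (of_nat (n + d + 1) * of_nat (n + d choose n) :: complex)"
    by (simp only: of_nat_mult[symmetric])
  have "of_nat (Suc n + d + 1) * of_nat ?C * complex_of_real (J (Suc n + d) (Suc n))
      = of_nat ?C * (of_nat (n + d + 2) * complex_of_real (J (Suc (n + d)) (Suc n)))"
    by simp
  also have "\<dots> = of_nat ?C * of_real (bernoulli (Suc n)) + (of_nat (Suc n) * of_nat ?C) * of_real (J (n + d) n)"
    unfolding rec by (simp only: distrib_left mult_ac)
  also have "\<dots> = of_nat ?C * of_real (bernoulli (Suc n)) + ?S n + of_nat (d + 1) * (1 / 2 - zeta (of_nat (d + 2)))"
    unfolding C Suc.IH by (simp only: add.assoc)
  also have "of_nat ?C * of_real (bernoulli (Suc n)) + ?S n = ?S (Suc n)"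
  proof (cases "even (Suc n)")
    case True
    then have "Suc n div 2 = Suc (n div 2)" "2 * Suc (n div 2) = Suc n" by presburger+
    then show ?thesis by (simp add: add_ac)
  next
    case False
    then have "Suc n div 2 = n div 2" by presburger
    moreover have "bernoulli (Suc n) = 0" using False Suc.hyps by (intro bernoulli_odd) auto
    ultimately show ?thesis by simp
  qed
  finally show ?case .
qed

lemma J_closed_form_pred:
  assumes "n \<ge> 1"
  shows "J (n - 1) n = (\<Sum>j = 1..n div 2. bernoulli (2 * j) / real (2 * j)) + 1 / 2 - euler_mascheroni"
  using assms
proof (induction n rule: nat_induct_at_least)
  case base
  show ?case using J_0_1 by simp
next
  case (Suc n)
  then obtain n' where n': "n = Suc n'" by (cases n) auto
  have "real (n' + 2) * J (Suc n') (Suc n) = bernoulli (Suc n) + real (Suc n) * J n' n"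
    using Suc by (intro J_recurrence) auto
  then have "J n (Suc n) = bernoulli (Suc n) / real (Suc n) + J n' n"
    by (simp add: n' field_simps)
  then have "J n (Suc n) = bernoulli (Suc n) / real (Suc n) + ((\<Sum>j = 1..n div 2. bernoulli (2 * j) / real (2 * j)) + 1 / 2 - euler_mascheroni)"
    using Suc.IH by (simp add: n')
  moreover have "bernoulli (Suc n) / real (Suc n) + (\<Sum>j = 1..n div 2. bernoulli (2 * j) / real (2 * j)) = (\<Sum>j = 1..Suc n div 2. bernoulli (2 * j) / real (2 * j))"
  proof (cases "even (Suc n)")
    case True
    then have "Suc n div 2 = Suc (n div 2)" "2 * Suc (n div 2) = Suc n" by presburger+
    then show ?thesis by (simp add: add_ac)
  next
    case False
    then have "Suc n div 2 = n div 2" by presburger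
    moreover have "bernoulli (Suc n) = 0" using False Suc.hyps by (intro bernoulli_odd) auto
    ultimately show ?thesis by simp
  qed
  ultimately show ?case by simp
qed

text \<open>The difference m = n - k stays fixed.  For k = 0 the sum consists of the single term B_m if m is even and
is empty if m is odd, in agreement with B_m = 0.\<close>
lemma J_closed_form_add:
  assumes m: "m \<ge> 2"
  shows "of_nat (k + 1) * complex_of_real (J k (k + m)) = of_nat (k + m choose k) *
     ((\<Sum>j = (m + 1) div 2..(k + m) div 2. of_real (bernoulli (2 * j)) / of_nat ((2 * j) choose (2 * j - m)))
       + of_nat m * of_nat (m - 1) * b_seq (m - 2))"
proof (induction k)
  case 0
  have "(\<Sum>j = (m + 1) div 2..m div 2. of_real (bernoulli (2 * j)) / of_nat ((2 * j) choose (2 * j - m))) = complex_of_real (bernoulli m)"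
  proof (cases "even m")
    case True
    then have "(m + 1) div 2 = m div 2" "2 * (m div 2) = m" by presburger+
    then show ?thesis by simp
  next
    case False
    then have "m div 2 < (m + 1) div 2" by presburger
    moreover have "bernoulli m = 0" using False m by (intro bernoulli_odd) auto
    ultimately show ?thesis by simp
  qed
  then show ?case using J_0_eq_b_seq[OF m] by simp
next
  case (Suc k)
  let ?C = "Suc k + m choose Suc k"
  let ?S = "\<lambda>k. \<Sum>j = (m + 1) div 2..(k + m) div 2. complex_of_real (bernoulli (2 * j)) / of_nat ((2 * j) choose (2 * j - m))"
  let ?b = "of_nat m * of_nat (m - 1) * b_seq (m - 2)"
  have "real (k + 2) * J (Suc k) (Suc (k + m)) = bernoulli (Suc (k + m)) + real (Suc (k + m)) * J k (k + m)"
    using m by (intro J_recurrence) auto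
  then have "complex_of_real (real (k + 2) * J (Suc k) (Suc (k + m))) = of_real (bernoulli (Suc (k + m)) + real (Suc (k + m)) * J k (k + m))"
    by (simp only:)
  then have rec: "of_nat (k + 2) * complex_of_real (J (Suc k) (Suc (k + m))) = of_real (bernoulli (Suc (k + m))) + of_nat (Suc (k + m)) * of_real (J k (k + m))"
    by (simp only: of_real_mult of_real_add of_real_of_nat_eq)
  have k1: "of_nat (k + 1) \<noteq> (0 :: complex)" by (simp only: of_nat_eq_0_iff)
  have "(k + 1) * ?C = Suc (k + m) * (k + m choose k)"
    using Suc_times_binomial[of k "k + m"] by simp
  then have C: "of_nat (k + 1) * of_nat ?C = (of_nat (Suc (k + m)) * of_nat (k + m choose k) :: complex)"
    by (simp only: of_nat_mult[symmetric])
  have "of_nat (k + 1) * (of_nat (Suc (k + m)) * complex_of_real (J k (k + m))) = of_nat (Suc (k + m)) * (of_nat (k + m choose k) * (?S k + ?b))"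
    unfolding Suc.IH[symmetric] by (simp only: mult_ac)
  also have "\<dots> = of_nat (k + 1) * (of_nat ?C * (?S k + ?b))" unfolding mult.assoc[symmetric] C by (simp only: mult_ac)
  finally have J: "of_nat (Suc (k + m)) * complex_of_real (J k (k + m)) = of_nat ?C * (?S k + ?b)"
    using k1 by (simp only: mult_cancel_left) simp
  have "of_real (bernoulli (Suc (k + m))) + of_nat ?C * ?S k = of_nat ?C * ?S (Suc k)"
  proof (cases "even (Suc (k + m))")
    case True
    then have d: "(Suc k + m) div 2 = Suc ((k + m) div 2)" "2 * Suc ((k + m) div 2) = Suc (k + m)" by presburger+
    have le: "(m + 1) div 2 \<le> Suc ((k + m) div 2)" by presburger
    have "?S (Suc k) = ?S k + of_real (bernoulli (Suc (k + m))) / of_nat (Suc (k + m) choose (Suc (k + m) - m))"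
      unfolding d(1) sum.nat_ivl_Suc'[OF le] d(2) by (simp only: add.commute)
    also have "Suc (k + m) - m = Suc k" by simp
    also have "of_nat (Suc (k + m) choose Suc k) \<noteq> (0 :: complex)" by (simp only: of_nat_eq_0_iff binomial_eq_0_iff)
    ultimately show ?thesis by (simp add: distrib_left del: binomial_Suc_Suc)
  next
    case False
    then have "(Suc k + m) div 2 = (k + m) div 2" by presburger
    moreover have "bernoulli (Suc (k + m)) = 0" using False m by (intro bernoulli_odd) auto
    ultimately show ?thesis by simp
  qed
  then show ?case using rec unfolding J by (simp add: distrib_left add.assoc del: binomial_Suc_Suc)
qed

theorem theorem2:
  fixes n :: nat
  assumes "n \<ge> 1"
  shows "(\<forall>k\<ge>n. complex_of_real (J k n) =
           1 / (of_nat (k + 1) * of_nat (k choose n)) *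
           ((\<Sum>j = 0..n div 2. of_nat ((k - n + 2 * j) choose (2 * j)) * of_real (bernoulli (2 * j)))
             + of_nat (k - n + 1) * (1 / 2 - zeta (of_nat (k - n + 2)))))
       \<and> J (n - 1) n = (\<Sum>j = 1..n div 2. bernoulli (2 * j) / real (2 * j)) + 1 / 2 - euler_mascheroni
       \<and> (\<forall>k. k + 2 \<le> n \<longrightarrow> complex_of_real (J k n) =
           1 / of_nat (k + 1) * of_nat (n choose k) *
           ((\<Sum>j = (n - k + 1) div 2..n div 2.
               of_real (bernoulli (2 * j)) / of_nat ((2 * j) choose (k + 2 * j - n)))
             + of_nat (n - k) * of_nat (n - k - 1) * b_seq (n - k - 2)))"
proof (intro conjI allI impI)
  fix k assume k: "n \<le> k"
  have "k choose n \<noteq> 0" using k by (simp add: binomial_eq_0_iff)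
  then have nz: "of_nat (k + 1) * of_nat (k choose n) \<noteq> (0 :: complex)"
    by (simp only: mult_eq_0_iff of_nat_eq_0_iff) simp
  have "of_nat (k + 1) * of_nat (k choose n) * complex_of_real (J k n) =
      (\<Sum>j=0..n div 2. of_nat (k - n + 2 * j choose (2 * j)) * of_real (bernoulli (2 * j))) +
      of_nat (k - n + 1) * (1 / 2 - zeta (of_nat (k - n + 2)))" (is "_ = ?R")
    using J_closed_form_ge[OF assms, of "k - n"] unfolding le_add_diff_inverse[OF k] .
  then have "complex_of_real (J k n) = ?R / (of_nat (k + 1) * of_nat (k choose n))"
    using nz by (metis nonzero_mult_div_cancel_left)
  then show "complex_of_real (J k n) = 1 / (of_nat (k + 1) * of_nat (k choose n)) * ?R"
    by (simp only: times_divide_eq_left mult_1)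
next
  show "J (n - 1) n = (\<Sum>j = 1..n div 2. bernoulli (2 * j) / real (2 * j)) + 1 / 2 - euler_mascheroni"
    by (rule J_closed_form_pred[OF assms])
next
  fix k assume k: "k + 2 \<le> n"
  define m where "m = n - k"
  have m: "m \<ge> 2" "n = k + m" using k by (auto simp: m_def)
  have nz: "of_nat (k + 1) \<noteq> (0 :: complex)" by (simp only: of_nat_eq_0_iff)
  have "k + 2 * j - n = 2 * j - m" for j using m by simp
  then have "of_nat (k + 1) * complex_of_real (J k n) = of_nat (n choose k) *
     ((\<Sum>j = (n - k + 1) div 2..n div 2. of_real (bernoulli (2 * j)) / of_nat ((2 * j) choose (k + 2 * j - n)))
       + of_nat (n - k) * of_nat (n - k - 1) * b_seq (n - k - 2))" (is "_ = ?C * ?R")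
    using J_closed_form_add[OF m(1), of k] unfolding m_def[symmetric] m(2)[symmetric] by (simp only:)
  then have "complex_of_real (J k n) = ?C * ?R / of_nat (k + 1)"
    using nz by (metis nonzero_mult_div_cancel_left)
  then show "complex_of_real (J k n) = 1 / of_nat (k + 1) * ?C * ?R"
    by (simp only: times_divide_eq_left times_divide_eq_right mult_1)
qed

end
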